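(* Let $\mathbb{X}\subseteq\mathbb{C}^{N+M}$ be an irreducible algebraic variety of dimension $N$ such that the projection $\Pi:\mathbb{X}\to\mathbb{C}^{N}$, $(z_1,\dots,z_{N+M})\mapsto(z_1,\dots,z_N)$, is finite (i.e. proper with finite fibers). Let $\Delta\subset\mathbb{C}^N$ be the discriminant locus of $\Pi$, and let $\mathcal{V}(\delta)$ be an algebraic hypersurface of $\mathbb{C}^{N}$ (the zero locus of a polynomial $\delta$) containing $\Delta$. Given a connected component $\mathcal{F}$ of the complement $\mathbb{R}^N\setminus\mathcal{A}_{\delta}$ of the amoeba of $\delta$, set $\Omega:=\mu^{-1}(\mathcal{F})$. Then for every connected component $\mathcal{C}$ of $\Pi^{-1}(\Omega)\cap\mathbb{X}$ there exist a natural number $d$ and a holomorphic map $\Psi:\xi_d^{-1}(\Omega)\to\mathbb{C}^{M}$ such that $$\mathcal{C}=\{(\xi_d(z),\Psi(z))\mid z\in\xi_d^{-1}(\Omega)\}.$$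
   Context: Natural numbers are positive here. The map $\mu:(\mathbb{C}^{*})^N\to\mathbb{R}^N$ is $\mu(z_1,\dots,z_N)=(\log|z_1|,\dots,\log|z_N|)$. The amoeba of a (Laurent) polynomial $\delta$ in $N$ variables is $\mathcal{A}_\delta:=\mu(\{z\in(\mathbb{C}^* )^N\mid\delta(z)=0\})$. For a natural number $d$, $\xi_d:\mathbb{C}^N\to\mathbb{C}^N$ is the map $\xi_d(z_1,\dots,z_N)=(z_1^d,\dots,z_N^d)$. The discriminant locus $\Delta$ of $\Pi$ is the intersection of all algebraic sets $\mathcal{A}\subset\mathbb{C}^N$ such that the restriction $\Pi:\mathbb{X}\setminus\Pi^{-1}(\mathcal{A})\to\Pi(\mathbb{X})\setminus\mathcal{A}$ is locally biholomorphic. *)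

theory Defs
  imports
    "HOL-Analysis.Analysis"
    "HOL-Library.Poly_Mapping"
    "HOL-Library.Extended_Nat"
begin

text \<open>
  Affine space of dimension \<open>N\<close> is \<^typ>\<open>complex ^ 'n\<close> with \<open>N = CARD('n)\<close>. Affine space of
  dimension \<open>N + M\<close> is \<^typ>\<open>complex ^ ('n + 'm)\<close>: the coordinates \<open>Inl i\<close> are the first \<open>N\<close>
  ones and the coordinates \<open>Inr j\<close> are the last \<open>M\<close> ones.
\<close>

text \<open>A polynomial maps each exponent vector to its coefficient.\<close>

type_synonym 'v cpoly = "('v \<Rightarrow>\<^sub>0 nat) \<Rightarrow>\<^sub>0 complex"

definition poly_eval :: "('v::finite) cpoly \<Rightarrow> complex ^ 'v \<Rightarrow> complex" where
  "poly_eval p z =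
     (\<Sum>e\<in>Poly_Mapping.keys p.
        Poly_Mapping.lookup p e * (\<Prod>i\<in>UNIV. (z $ i) ^ Poly_Mapping.lookup e i))"

definition zero_locus :: "('v::finite) cpoly \<Rightarrow> (complex ^ 'v) set" where
  "zero_locus p = {z. poly_eval p z = 0}"

definition algebraic_set :: "(complex ^ ('v::finite)) set \<Rightarrow> bool" where
  "algebraic_set A \<longleftrightarrow> (\<exists>P :: 'v cpoly set. A = {z. \<forall>p\<in>P. poly_eval p z = 0})"

definition irreducible_variety :: "(complex ^ ('v::finite)) set \<Rightarrow> bool" where
  "irreducible_variety X \<longleftrightarrow>
     algebraic_set X \<and> X \<noteq> {} \<and>
     (\<forall>A B. algebraic_set A \<and> algebraic_set B \<and> X = A \<union> B \<longrightarrow> X = A \<or> X = B)"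

text \<open>
  Krull dimension: the supremum of the lengths \<open>n\<close> of chains
  \<open>Z 0 \<subset> Z 1 \<subset> \<dots> \<subset> Z n\<close> of irreducible subvarieties. (The empty set gets \<open>0\<close>;
  this is only used for nonempty sets.)
\<close>

definition variety_dim :: "(complex ^ ('v::finite)) set \<Rightarrow> enat" where
  "variety_dim X =
     (SUP n \<in> {n. \<exists>Z :: nat \<Rightarrow> (complex ^ 'v) set.
                 (\<forall>i\<le>n. irreducible_variety (Z i) \<and> Z i \<subseteq> X) \<and>
                 (\<forall>i<n. Z i \<subset> Z (Suc i))}. enat n)"

text \<open>
  For open \<open>U\<close>: the real Frechet derivative exists and is complex linear, i.e. given by a
  complex matrix.
\<close>

definition holomorphic_map_on ::
    "(complex ^ ('a::finite) \<Rightarrow> complex ^ ('b::finite)) \<Rightarrow> (complex ^ 'a) set \<Rightarrow> bool" where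
  "holomorphic_map_on f U \<longleftrightarrow>
     (\<forall>z\<in>U. \<exists>J :: complex ^ 'a ^ 'b. (f has_derivative (\<lambda>v. J *v v)) (at z))"

text \<open>
  On a subset that need not be open, such as an analytic set, holomorphic means being locally
  the restriction of a holomorphic map of the ambient space.
\<close>

definition holomorphic_map_on_subset ::
    "(complex ^ ('a::finite) \<Rightarrow> complex ^ ('b::finite)) \<Rightarrow> (complex ^ 'a) set \<Rightarrow> bool" where
  "holomorphic_map_on_subset f S \<longleftrightarrow>
     (\<forall>x\<in>S. \<exists>W F. open W \<and> x \<in> W \<and> holomorphic_map_on F W \<and> (\<forall>y\<in>W \<inter> S. F y = f y))"

definition biholomorphic_between ::
    "(complex ^ ('a::finite) \<Rightarrow> complex ^ ('b::finite)) \<Rightarrow>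
     (complex ^ 'a) set \<Rightarrow> (complex ^ 'b) set \<Rightarrow> bool" where
  "biholomorphic_between f S T \<longleftrightarrow>
     bij_betw f S T \<and> holomorphic_map_on_subset f S \<and>
     holomorphic_map_on_subset (inv_into S f) T"

definition locally_biholomorphic ::
    "(complex ^ ('a::finite) \<Rightarrow> complex ^ ('b::finite)) \<Rightarrow>
     (complex ^ 'a) set \<Rightarrow> (complex ^ 'b) set \<Rightarrow> bool" where
  "locally_biholomorphic f S T \<longleftrightarrow>
     (\<forall>x\<in>S. \<exists>U V. openin (top_of_set S) U \<and> x \<in> U \<and> openin (top_of_set T) V \<and>
                  biholomorphic_between f U V)"

definition proj :: "complex ^ ('n::finite + 'm::finite) \<Rightarrow> complex ^ 'n" where
  "proj z = (\<chi> i. z $ Inl i)"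

definition append_vec :: "complex ^ ('n::finite) \<Rightarrow> complex ^ ('m::finite) \<Rightarrow> complex ^ ('n + 'm)" where
  "append_vec z w = (\<chi> k. case k of Inl i \<Rightarrow> z $ i | Inr j \<Rightarrow> w $ j)"

definition finite_projection :: "(complex ^ ('n::finite + 'm::finite)) set \<Rightarrow> bool" where
  "finite_projection X \<longleftrightarrow>
     proper_map (top_of_set X) (euclidean :: (complex ^ 'n) topology) proj \<and>
     (\<forall>w :: complex ^ 'n. finite {x \<in> X. proj x = w})"

definition discriminant_locus :: "(complex ^ ('n::finite + 'm::finite)) set \<Rightarrow> (complex ^ 'n) set" where
  "discriminant_locus X =
     \<Inter> {A. algebraic_set A \<and> locally_biholomorphic proj (X - proj -` A) (proj ` X - A)}"

definition torus :: "(complex ^ ('n::finite)) set" where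
  "torus = {z. \<forall>i. z $ i \<noteq> 0}"

text \<open>Only used on \<^const>\<open>torus\<close>; outside it the value is meaningless.\<close>

definition log_map :: "complex ^ ('n::finite) \<Rightarrow> real ^ 'n" where
  "log_map z = (\<chi> i. ln (cmod (z $ i)))"

definition amoeba :: "('n::finite) cpoly \<Rightarrow> (real ^ 'n) set" where
  "amoeba p = log_map ` (torus \<inter> zero_locus p)"

definition log_preimage :: "(real ^ ('n::finite)) set \<Rightarrow> (complex ^ 'n) set" where
  "log_preimage F = {z \<in> torus. log_map z \<in> F}"

definition power_map :: "nat \<Rightarrow> complex ^ ('n::finite) \<Rightarrow> complex ^ 'n" where
  "power_map d z = (\<chi> i. (z $ i) ^ d)"

end

theory Submission
  imports
    Defs
    "HOL-Computational_Algebra.Polynomial"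
    "HOL-Computational_Algebra.Fundamental_Theorem_Algebra"
    "HOL-Complex_Analysis.Winding_Numbers"
    "HOL-Complex_Analysis.Cauchy_Integral_Formula"
begin

text \<open>
  Away from \<open>\<Delta>\<close> the projection is a local homeomorphism onto its image. That the image is all of
  \<open>\<complex>\<^sup>N\<close> follows from \<open>dim X = N\<close>: a chain of \<open>N + 1\<close> irreducible varieties gives \<open>N\<close>
  algebraically independent polynomials on \<open>X\<close>, and the image of \<open>X\<close> under algebraically
  independent polynomials contains the complement of a hypersurface. If the first \<open>N\<close> coordinates
  were dependent, the part of \<open>X\<close> over the complement of \<open>V(\<delta>)\<close> would be a countable union of
  graphs over null sets, and its image under any \<open>N\<close> polynomials would be null. So they are
  independent, and the image, being closed, is everything.

  Hence \<open>X\<close> is a finite covering over \<open>\<Omega>\<close>. The component \<open>F\<close> is convex, because two points of \<open>F\<close> that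
  differ by a multiple of an integer vector bound a segment on which the argument principle
  leaves no room for zeros of \<open>\<delta>\<close>. The tube over \<open>F\<close> is therefore convex, and the
  componentwise exponential lifts to a map of the tube onto the given component \<open>C\<close>. Finite fibers make
  the lift periodic under \<open>2\<pi>id\<int>\<^sup>N\<close> for some \<open>d\<close>, so it factors through \<open>z = exp (w / d)\<close>.
\<close>

subsection \<open>Substitution into polynomials\<close>

text \<open>Off the discriminant locus the sheets of \<open>X\<close> are by definition
  biholomorphic only to relatively open subsets of the image of \<open>X\<close>, and these need not
  be open in the base. Lifting the exponential needs evenly covered open sets, so surjectivity has
  to come before all topology. The obstacle is that \<open>variety_dim\<close> speaks of chains of
  algebraic sets and says nothing about size, whereas differentiable maps between spaces of equal
  dimension respect null sets. Algebraic independence links the two: a chain produces it, and it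
  forces the values to fill the complement of a null set. These values are realised by points of
  \<open>X\<close> through extending ring homomorphisms into the complex numbers, one coordinate at
  a time. Demanding also that a chosen polynomial stay nonzero at the point carries the induction,
  and it keeps the points away from the zero locus of \<delta>, so that local sections are available
  at them.\<close>

definition psubst ::
    "(complex \<Rightarrow> 'r::comm_ring_1) \<Rightarrow> ('v::finite \<Rightarrow> 'r) \<Rightarrow> 'v cpoly \<Rightarrow> 'r" where
  "psubst \<iota> x p =
     (\<Sum>e\<in>Poly_Mapping.keys p.
        \<iota> (Poly_Mapping.lookup p e) * (\<Prod>i\<in>UNIV. x i ^ Poly_Mapping.lookup e i))"

definition pconst :: "complex \<Rightarrow> ('v::finite) cpoly" where
  "pconst c = Poly_Mapping.single 0 c"

definition pvar :: "'v::finite \<Rightarrow> 'v cpoly" where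
  "pvar i = Poly_Mapping.single (Poly_Mapping.single i 1) 1"

definition ring_hom_fun :: "('a::comm_ring_1 \<Rightarrow> 'b::comm_ring_1) \<Rightarrow> bool" where
  "ring_hom_fun h \<longleftrightarrow> h 1 = 1 \<and> (\<forall>a b. h (a + b) = h a + h b) \<and> (\<forall>a b. h (a * b) = h a * h b)"

lemma ring_hom_funD:
  assumes "ring_hom_fun h"
  shows "h 0 = 0" "h 1 = 1" "h (a + b) = h a + h b" "h (a * b) = h a * h b"
    "h (- a) = - h a" "h (a - b) = h a - h b"
proof -
  show *: "h 0 = 0" "h 1 = 1" "h (a * b) = h a * h b"
    using assms unfolding ring_hom_fun_def by (auto, metis add_cancel_right_right)
  show add: "h (a + b) = h a + h b" for a b
    using assms unfolding ring_hom_fun_def by auto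
  show neg: "h (- a) = - h a" for a
    using add[of "- a" a] * by (simp add: eq_neg_iff_add_eq_0)
  show "h (a - b) = h a - h b"
    using add[of a "- b"] neg[of b] by simp
qed

lemma ring_hom_fun_power: "ring_hom_fun h \<Longrightarrow> h (a ^ n) = h a ^ n"
  by (induction n) (simp_all add: ring_hom_funD)

lemma ring_hom_fun_sum: "ring_hom_fun h \<Longrightarrow> h (\<Sum>i\<in>A. f i) = (\<Sum>i\<in>A. h (f i))"
  by (induction A rule: infinite_finite_induct) (simp_all add: ring_hom_funD)

lemma ring_hom_fun_prod: "ring_hom_fun h \<Longrightarrow> h (\<Prod>i\<in>A. f i) = (\<Prod>i\<in>A. h (f i))"
  by (induction A rule: infinite_finite_induct) (simp_all add: ring_hom_funD)

lemma ring_hom_fun_poly: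
  assumes "ring_hom_fun h"
  shows "h (poly p x) = poly (map_poly h p) (h x)"
  by (induction p) (simp_all add: map_poly_pCons ring_hom_funD[OF assms])

lemma poly_mapping_sum_monomials:
  "p = (\<Sum>e\<in>Poly_Mapping.keys p. Poly_Mapping.single e (Poly_Mapping.lookup p e))"
proof (rule poly_mapping_eqI)
  fix k
  show "Poly_Mapping.lookup p k =
      Poly_Mapping.lookup (\<Sum>e\<in>Poly_Mapping.keys p. Poly_Mapping.single e (Poly_Mapping.lookup p e)) k"
    by (auto simp: lookup_sum lookup_single when_def in_keys_iff)
qed

lemma poly_mapping_monom_induct [case_names monom add]:
  fixes p :: "'a \<Rightarrow>\<^sub>0 'b::comm_monoid_add"
  assumes "\<And>e c. P (Poly_Mapping.single e c)" "\<And>p q. P p \<Longrightarrow> P q \<Longrightarrow> P (p + q)"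
  shows "P p"
proof -
  have "P (\<Sum>e\<in>A. Poly_Mapping.single e (f e))" if "finite A" for A and f :: "'a \<Rightarrow> 'b"
    using that
  proof (induction A)
    case empty
    then show ?case using assms(1)[of undefined 0] by simp
  qed (use assms in auto)
  then show ?thesis
    by (metis poly_mapping_sum_monomials finite_keys)
qed

text \<open>Terms may cancel in a sum of polynomials; summing over a common larger set of exponents
  makes additivity a termwise fact.\<close>

lemma psubst_superset:
  assumes "\<iota> 0 = 0" "finite K" "Poly_Mapping.keys p \<subseteq> K"
  shows "psubst \<iota> x p = (\<Sum>e\<in>K. \<iota> (Poly_Mapping.lookup p e) * (\<Prod>i\<in>UNIV. x i ^ Poly_Mapping.lookup e i))"
  unfolding psubst_def using assms
  by (intro sum.mono_neutral_left) (auto simp: in_keys_iff)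

context
  fixes \<iota> :: "complex \<Rightarrow> 'r::comm_ring_1" and x :: "'v::finite \<Rightarrow> 'r"
  assumes \<iota>: "ring_hom_fun \<iota>"
begin

lemma psubst_single:
  "psubst \<iota> x (Poly_Mapping.single e c) = \<iota> c * (\<Prod>i\<in>UNIV. x i ^ Poly_Mapping.lookup e i)"
  by (subst psubst_superset[where K = "{e}"]) (auto simp: ring_hom_funD[OF \<iota>])

lemma psubst_add: "psubst \<iota> x (p + q) = psubst \<iota> x p + psubst \<iota> x q"
proof -
  let ?K = "Poly_Mapping.keys p \<union> Poly_Mapping.keys q"
  have "Poly_Mapping.keys (p + q) \<subseteq> ?K" by (rule Poly_Mapping.keys_add)
  then show ?thesis
    by (simp add: psubst_superset[where K = ?K] ring_hom_funD[OF \<iota>] lookup_add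
        sum.distrib distrib_right)
qed

lemma psubst_mult: "psubst \<iota> x (p * q) = psubst \<iota> x p * psubst \<iota> x q"
proof (induction p rule: poly_mapping_monom_induct)
  case (monom e c)
  show ?case
  proof (induction q rule: poly_mapping_monom_induct)
    case (monom e' c')
    show ?case
      by (simp add: mult_single psubst_single ring_hom_funD[OF \<iota>] lookup_add power_add
          prod.distrib)
  qed (simp add: psubst_add distrib_left)
qed (simp add: psubst_add distrib_right)

lemma psubst_pconst: "psubst \<iota> x (pconst c) = \<iota> c"
  by (simp add: pconst_def psubst_single)

lemma psubst_pvar: "psubst \<iota> x (pvar i) = x i"
proof -
  have "(\<Prod>j\<in>UNIV. x j ^ Poly_Mapping.lookup (Poly_Mapping.single i (1::nat)) j)
      = (\<Prod>j\<in>UNIV. if j = i then x j else 1)"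
    by (intro prod.cong) (auto simp: lookup_single when_def)
  then show ?thesis
    by (simp add: pvar_def psubst_single ring_hom_funD[OF \<iota>])
qed

lemma ring_hom_psubst: "ring_hom_fun (psubst \<iota> x)"
proof -
  have "psubst \<iota> x 1 = 1"
    using psubst_pconst[of 1] by (simp add: pconst_def ring_hom_funD[OF \<iota>])
  then show ?thesis
    by (simp add: ring_hom_fun_def psubst_add psubst_mult)
qed

end

text \<open>A homomorphism only changes the coefficient map and the substituted values. This is why
  the coefficient map is a parameter: the one rule yields evaluation of composites, restriction to a
  complex line, and the identification of a homomorphism with evaluation at a point.\<close>

lemma ring_hom_compose_psubst:
  assumes "ring_hom_fun h"
  shows "h (psubst \<iota> x p) = psubst (\<lambda>c. h (\<iota> c)) (\<lambda>i. h (x i)) p"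
  unfolding psubst_def
  by (simp add: ring_hom_fun_sum[OF assms] ring_hom_funD[OF assms] ring_hom_fun_prod[OF assms]
      ring_hom_fun_power[OF assms])

lemma poly_eval_psubst: "poly_eval p z = psubst id (($) z) p"
  by (simp add: poly_eval_def psubst_def)

lemma poly_eval_lambda: "poly_eval p (\<chi> i. x i) = psubst (\<lambda>c. c) x p"
  by (simp add: poly_eval_def psubst_def)

lemma ring_hom_id: "ring_hom_fun id"
  by (simp add: ring_hom_fun_def)

lemma ring_hom_pconst: "ring_hom_fun pconst"
  by (simp add: ring_hom_fun_def pconst_def single_add mult_single)

lemma ring_hom_poly_eval: "ring_hom_fun (\<lambda>p. poly_eval p z)"
  unfolding poly_eval_psubst by (rule ring_hom_psubst[OF ring_hom_id])

lemmas poly_eval_ring = ring_hom_funD[OF ring_hom_poly_eval]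

lemma poly_eval_pconst [simp]: "poly_eval (pconst c) z = c"
  and poly_eval_pvar [simp]: "poly_eval (pvar i) z = z $ i"
  by (simp_all add: poly_eval_psubst psubst_pconst[OF ring_hom_id] psubst_pvar[OF ring_hom_id])

lemma poly_eval_compose:
  "poly_eval (psubst pconst f g) z = poly_eval g (\<chi> i. poly_eval (f i) z)"
  by (simp add: ring_hom_compose_psubst[OF ring_hom_poly_eval] poly_eval_lambda)

text \<open>Constants and variables generate all polynomials: a subring containing them is
  everything, and a homomorphism fixing constants is determined by its values on the
  variables.\<close>

lemma psubst_pconst_pvar: "psubst pconst pvar p = p"
proof (induction p rule: poly_mapping_monom_induct)
  case (monom e c)
  have pw: "pvar i ^ k = Poly_Mapping.single (Poly_Mapping.single i k) 1" for i :: 'a and k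
    by (induction k) (simp_all add: pvar_def mult_single flip: single_add)
  have "(\<Prod>i\<in>A. pvar i ^ Poly_Mapping.lookup e i)
      = Poly_Mapping.single (\<Sum>i\<in>A. Poly_Mapping.single i (Poly_Mapping.lookup e i)) 1" if "finite A" for A
    using that by (induction A) (simp_all add: pw mult_single)
  from this[of UNIV] have "(\<Prod>i\<in>UNIV. pvar i ^ Poly_Mapping.lookup e i)
      = Poly_Mapping.single (\<Sum>i\<in>UNIV. Poly_Mapping.single i (Poly_Mapping.lookup e i)) 1" by simp
  moreover have "(\<Sum>i\<in>UNIV. Poly_Mapping.single i (Poly_Mapping.lookup e i)) = e"
    by (rule poly_mapping_eqI) (simp add: lookup_sum lookup_single when_def)
  ultimately show ?case
    by (simp add: psubst_single[OF ring_hom_pconst]) (simp add: pconst_def mult_single)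
qed (simp add: psubst_add[OF ring_hom_pconst])

lemma poly_eval_line:
  obtains q where "\<And>t. poly q t = poly_eval p (\<chi> i. z $ i + t * v $ i)"
proof
  fix t :: complex
  have h: "ring_hom_fun (\<lambda>q. poly q t)" by (simp add: ring_hom_fun_def)
  show "poly (psubst (\<lambda>c. [:c:]) (\<lambda>i. [:z $ i, v $ i:]) p) t
      = poly_eval p (\<chi> i. z $ i + t * v $ i)"
    by (simp add: poly_eval_lambda ring_hom_compose_psubst[OF h, where p = p])
qed

lemma continuous_on_poly_eval: "continuous_on S (poly_eval p)"
  unfolding poly_eval_def by (intro continuous_intros)

lemma closed_zero_locus: "closed (zero_locus p)"
  unfolding zero_locus_def
  using continuous_closed_vimage[of "{0}" "poly_eval p"] continuous_on_poly_eval[of UNIV p]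
  by (simp add: continuous_on_eq_continuous_at vimage_def)

lemma closed_algebraic_set: "algebraic_set A \<Longrightarrow> closed A"
proof -
  assume "algebraic_set A"
  then obtain P where "A = (\<Inter>p\<in>P. zero_locus p)"
    unfolding algebraic_set_def zero_locus_def by auto
  then show "closed A" using closed_zero_locus by auto
qed

section \<open>Nonzero polynomials are nonzero functions\<close>

definition vars_in :: "'v set \<Rightarrow> ('v::finite) cpoly \<Rightarrow> bool" where
  "vars_in S g \<longleftrightarrow> (\<forall>e\<in>Poly_Mapping.keys g. \<forall>i. i \<notin> S \<longrightarrow> Poly_Mapping.lookup e i = 0)"

lemma vars_in_add: "vars_in S p \<Longrightarrow> vars_in S q \<Longrightarrow> vars_in S (p + q)"
  unfolding vars_in_def using Poly_Mapping.keys_add[of p q] by blast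

lemma vars_in_0: "vars_in S 0" by (simp add: vars_in_def)

lemma vars_in_insertE:
  assumes "vars_in (insert k S) g"
  obtains q where "g = poly q (pvar k)" "\<And>j. vars_in S (coeff q j)"
proof -
  \<comment> \<open>\<open>r e\<close> erases the \<open>k\<close>-entry of the exponent; the erased
    entry becomes the degree in the univariate polynomial \<open>q\<close>.\<close>
  define r where "r e = (Poly_Mapping.update k 0 e :: 'a \<Rightarrow>\<^sub>0 nat)" for e
  define q where "q = (\<Sum>e\<in>Poly_Mapping.keys g.
      monom (Poly_Mapping.single (r e) (Poly_Mapping.lookup g e)) (Poly_Mapping.lookup e k))"
  have pw: "pvar k ^ j = Poly_Mapping.single (Poly_Mapping.single k j) 1" for j
    by (induction j) (simp_all add: pvar_def mult_single flip: single_add)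
  have re: "r e + Poly_Mapping.single k (Poly_Mapping.lookup e k) = e" for e
    by (rule poly_mapping_eqI) (simp add: r_def lookup_add lookup_update lookup_single when_def)
  have "poly q (pvar k) = (\<Sum>e\<in>Poly_Mapping.keys g. Poly_Mapping.single e (Poly_Mapping.lookup g e))"
    by (simp add: q_def poly_sum poly_monom pw mult_single re)
  then have "g = poly q (pvar k)" using poly_mapping_sum_monomials[of g] by simp
  moreover have "vars_in S (coeff q j)" for j
  proof -
    have "vars_in S (Poly_Mapping.single (r e) (Poly_Mapping.lookup g e))"
      if "e \<in> Poly_Mapping.keys g" for e
      using assms that by (auto simp: vars_in_def r_def lookup_update split: if_splits)
    note single = this
    have "vars_in S (\<Sum>e\<in>A. coeff (monom (Poly_Mapping.single (r e) (Poly_Mapping.lookup g e))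
        (Poly_Mapping.lookup e k)) j)" if "A \<subseteq> Poly_Mapping.keys g" "finite A" for A
      using that(2,1) by (induction A) (auto simp: vars_in_0 single intro!: vars_in_add)
    then show ?thesis by (simp add: q_def coeff_sum)
  qed
  ultimately show ?thesis using that by blast
qed

lemma poly_eval_vars_in_cong:
  assumes "vars_in S g" "\<And>i. i \<in> S \<Longrightarrow> z $ i = w $ i"
  shows "poly_eval g z = poly_eval g w"
proof -
  have "(\<Prod>i\<in>UNIV. (z $ i) ^ Poly_Mapping.lookup e i) = (\<Prod>i\<in>UNIV. (w $ i) ^ Poly_Mapping.lookup e i)"
    if "e \<in> Poly_Mapping.keys g" for e
    using assms that unfolding vars_in_def by (intro prod.cong) (auto, metis power_0)
  then show ?thesis unfolding poly_eval_def by (intro sum.cong) auto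
qed

text \<open>One variable is split off at a time: a nonzero coefficient is nonzero at some choice of
  the other variables, and the resulting univariate polynomial has only finitely many roots.\<close>

lemma poly_eval_nonzero_aux:
  fixes S :: "'v::finite set"
  shows "vars_in S g \<Longrightarrow> g \<noteq> 0 \<Longrightarrow> \<exists>z. poly_eval g z \<noteq> 0"
proof (induction S arbitrary: g rule: infinite_finite_induct)
  case (infinite A)
  then show ?case by simp
next
  case empty
  note 1 = this
  then have "Poly_Mapping.keys g \<subseteq> {0}"
    by (auto simp: vars_in_def intro!: poly_mapping_eqI)
  then have "Poly_Mapping.keys g = {0}" using 1(2) keys_eq_empty subset_singletonD by metis
  then have "poly_eval g 0 = Poly_Mapping.lookup g 0" "Poly_Mapping.lookup g 0 \<noteq> 0"
    by (auto simp: poly_eval_def in_keys_iff)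
  then show ?case by metis
next
  case (insert k S)
  note 2 = this
  obtain q where q: "g = poly q (pvar k)" "\<And>j. vars_in S (coeff q j)"
    using vars_in_insertE[OF 2(4)] by blast
  have "q \<noteq> 0" using q(1) 2(5) by auto
  then obtain j where "coeff q j \<noteq> 0" by (metis leading_coeff_0_iff)
  with 2(3)[OF q(2)] obtain z where z: "poly_eval (coeff q j) z \<noteq> 0" by blast
  define P where "P = map_poly (\<lambda>c. poly_eval c z) q"
  have "coeff P j \<noteq> 0" using z by (simp add: P_def coeff_map_poly poly_eval_ring)
  then have "P \<noteq> 0" by auto
  then have "finite {t. poly P t = 0}" by (rule poly_roots_finite)
  then obtain t where t: "poly P t \<noteq> 0"
    using ex_new_if_finite[OF infinite_UNIV_char_0] by blast
  define w where "w = (\<chi> i. if i = k then t else z $ i)"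
  have "poly_eval (coeff q i) w = poly_eval (coeff q i) z" for i
    by (rule poly_eval_vars_in_cong[OF q(2)]) (use 2(2) in \<open>auto simp: w_def\<close>)
  then have "map_poly (\<lambda>c. poly_eval c w) q = P"
    unfolding P_def by (intro poly_eqI) (simp add: coeff_map_poly poly_eval_ring)
  then have "poly_eval g w = poly P t"
    using ring_hom_fun_poly[OF ring_hom_poly_eval, of q "pvar k" w] q(1) by (simp add: w_def)
  then show ?case using t by metis
qed

lemma poly_eval_nonzero: "g \<noteq> 0 \<Longrightarrow> \<exists>z. poly_eval g z \<noteq> 0"
  by (rule poly_eval_nonzero_aux[where S = UNIV]) (auto simp: vars_in_def)

subsection \<open>Chains of irreducible varieties give algebraically independent polynomials\<close>

definition vanishing_ideal :: "(complex ^ 'v::finite) set \<Rightarrow> 'v cpoly set" where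
  "vanishing_ideal X = {p. \<forall>x\<in>X. poly_eval p x = 0}"

lemma algebraic_set_Int_zero_locus:
  assumes "algebraic_set X"
  shows "algebraic_set (X \<inter> zero_locus p)"
proof -
  obtain P where "X = {z. \<forall>p\<in>P. poly_eval p z = 0}"
    using assms unfolding algebraic_set_def by blast
  then have "X \<inter> zero_locus p = {z. \<forall>q\<in>insert p P. poly_eval q z = 0}"
    by (auto simp: zero_locus_def)
  then show ?thesis unfolding algebraic_set_def by blast
qed

text \<open>The zero loci of the two factors cut \<open>X\<close> into two algebraic subsets that
  cover it, so irreducibility makes one of them all of \<open>X\<close>.\<close>

lemma vanishing_ideal_prime:
  assumes "irreducible_variety X" "p * q \<in> vanishing_ideal X"
  shows "p \<in> vanishing_ideal X \<or> q \<in> vanishing_ideal X"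
proof -
  have "algebraic_set (X \<inter> zero_locus p)" "algebraic_set (X \<inter> zero_locus q)"
    using assms(1) by (auto simp: irreducible_variety_def intro: algebraic_set_Int_zero_locus)
  moreover have "X = (X \<inter> zero_locus p) \<union> (X \<inter> zero_locus q)"
    using assms(2) by (auto simp: vanishing_ideal_def zero_locus_def poly_eval_ring)
  ultimately have "X = X \<inter> zero_locus p \<or> X = X \<inter> zero_locus q"
    using assms(1) unfolding irreducible_variety_def by blast
  then show ?thesis by (auto simp: vanishing_ideal_def zero_locus_def)
qed

lemma algebraic_subset_separate:
  assumes "algebraic_set A" "A \<subset> B"
  obtains f where "f \<in> vanishing_ideal A" "f \<notin> vanishing_ideal B"
proof -
  obtain P where P: "A = {z. \<forall>p\<in>P. poly_eval p z = 0}"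
    using assms unfolding algebraic_set_def by blast
  obtain x where "x \<in> B" "x \<notin> A" using assms by blast
  then obtain p where "p \<in> P" "poly_eval p x \<noteq> 0" using P by blast
  then show ?thesis using that[of p] P \<open>x \<in> B\<close> by (auto simp: vanishing_ideal_def)
qed

definition independent_on :: "('n::finite \<Rightarrow> ('v::finite) cpoly) \<Rightarrow> (complex ^ 'v) set \<Rightarrow> bool" where
  "independent_on f X \<longleftrightarrow> (\<forall>g. psubst pconst f g \<in> vanishing_ideal X \<longrightarrow> g = 0)"

text \<open>Each strict inclusion supplies a polynomial that vanishes on the smaller variety but not
  on the larger. In a relation on the larger variety, restriction to the smaller one isolates the
  constant term in the newest polynomial; that term is zero by induction, and primality then allows
  one factor of the newest polynomial to be cancelled.\<close>

lemma chain_independent: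
  fixes Z :: "nat \<Rightarrow> (complex ^ 'v::finite) set"
  assumes irr: "\<And>i. i \<le> CARD('n) \<Longrightarrow> irreducible_variety (Z i)"
    and sub: "\<And>i. i < CARD('n) \<Longrightarrow> Z i \<subset> Z (Suc i)"
  obtains f :: "'n::finite \<Rightarrow> 'v cpoly" where "independent_on f (Z (CARD('n)))"
proof -
  obtain idx :: "'n \<Rightarrow> nat" where idx: "bij_betw idx UNIV {0..<CARD('n)}"
    using ex_bij_betw_finite_nat[of "UNIV :: 'n set"] by auto
  then have lt: "idx i < CARD('n)" for i by (auto simp: bij_betw_def)
  have "\<exists>f. f \<in> vanishing_ideal (Z (idx i)) \<and> f \<notin> vanishing_ideal (Z (Suc (idx i)))" for i
  proof -
    have "algebraic_set (Z (idx i))"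
      using irr[of "idx i"] lt[of i] by (simp add: irreducible_variety_def)
    from algebraic_subset_separate[OF this sub[OF lt[of i]]] show ?thesis by blast
  qed
  then obtain f where f: "\<And>i. f i \<in> vanishing_ideal (Z (idx i))"
      "\<And>i. f i \<notin> vanishing_ideal (Z (Suc (idx i)))" by metis
  let ?\<sigma> = "psubst pconst f"
  note \<sigma> = ring_hom_psubst[OF ring_hom_pconst, of f]
  \<comment> \<open>Generalised to the polynomials of the first \<open>k\<close> inclusions, with
    the relation required only on \<open>Z k\<close>.\<close>
  have main: "g = 0" if "k \<le> CARD('n)" "vars_in {i. idx i < k} g" "?\<sigma> g \<in> vanishing_ideal (Z k)" for g k
    using that
  proof (induction k arbitrary: g)
    case 0
    \<comment> \<open>No variable is left, so \<open>g\<close> is constant, and a point of the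
      nonempty \<open>Z 0\<close> shows that the constant is zero.\<close>
    obtain x where x: "x \<in> Z 0" using irr[of 0] by (auto simp: irreducible_variety_def)
    show ?case
    proof (rule ccontr)
      assume "g \<noteq> 0"
      then obtain z where z: "poly_eval g z \<noteq> 0" using poly_eval_nonzero by blast
      have "poly_eval g z = poly_eval g (\<chi> i. poly_eval (f i) x)"
        using 0 by (intro poly_eval_vars_in_cong[of "{}"]) auto
      also have "\<dots> = 0" using 0(3) x by (simp add: vanishing_ideal_def poly_eval_compose)
      finally show False using z by simp
    qed
  next
    case (Suc k)
    have "k \<in> idx ` UNIV" using idx Suc.prems(1) by (simp add: bij_betw_def)
    then obtain i where i: "idx i = k" by blast
    have "{j. idx j < Suc k} = insert i {j. idx j < k}"
      using idx i by (auto simp: bij_betw_def inj_def less_Suc_eq)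
    then obtain q where q: "g = poly q (pvar i)" "\<And>j. vars_in {j. idx j < k} (coeff q j)"
      using vars_in_insertE[of i "{j. idx j < k}" g] Suc.prems(2) by auto
    \<comment> \<open>The coefficients are removed from the constant term upwards, which is the
      shape of the induction on \<open>pCons\<close>.\<close>
    have "poly (map_poly ?\<sigma> p) (f i) \<in> vanishing_ideal (Z (Suc k)) \<Longrightarrow> p = 0"
      if "\<And>j. vars_in {j. idx j < k} (coeff p j)" for p
      using that
    proof (induction p)
      case 0
      then show ?case by simp
    next
      case (pCons a p)
      note prems = pCons.prems
      have a: "vars_in {j. idx j < k} a" and p: "vars_in {j. idx j < k} (coeff p j)" for j
        using prems(2)[of 0] prems(2)[of "Suc j"] by simp_all
      define r where "r = poly (map_poly ?\<sigma> p) (f i)"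
      have eq: "poly (map_poly ?\<sigma> (pCons a p)) (f i) = ?\<sigma> a + f i * r"
        by (simp add: r_def map_poly_pCons ring_hom_funD[OF \<sigma>])
      have "?\<sigma> a \<in> vanishing_ideal (Z k)"
        unfolding vanishing_ideal_def
      proof safe
        fix x assume "x \<in> Z k"
        then have "x \<in> Z (Suc k)" "poly_eval (f i) x = 0"
          using sub[of k] Suc.prems(1) f(1)[of i] i by (auto simp: vanishing_ideal_def)
        then show "poly_eval (?\<sigma> a) x = 0"
          using prems(1) unfolding eq by (auto simp: vanishing_ideal_def poly_eval_ring)
      qed
      with Suc.IH[OF _ a] Suc.prems(1) have [simp]: "a = 0" by simp
      have "f i * r \<in> vanishing_ideal (Z (Suc k))"
        using prems(1) unfolding eq by (simp add: ring_hom_funD[OF \<sigma>])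
      then have "r \<in> vanishing_ideal (Z (Suc k))"
        using vanishing_ideal_prime[OF irr] Suc.prems(1) f(2)[of i] i by blast
      then have "p = 0" using pCons.IH p unfolding r_def by blast
      then show ?case by simp
    qed
    moreover have "?\<sigma> g = poly (map_poly ?\<sigma> q) (f i)"
      unfolding q(1) by (simp add: ring_hom_fun_poly[OF \<sigma>] psubst_pvar[OF ring_hom_pconst])
    ultimately have "q = 0" using q(2) Suc.prems(3) by simp
    then show ?case using q(1) by simp
  qed
  have "independent_on f (Z (CARD('n)))"
    unfolding independent_on_def using main[OF order_refl] lt by (simp add: vars_in_def)
  then show ?thesis using that by blast
qed

text \<open>If all chains were shorter than \<open>n\<close>, the supremum would be at most
  \<open>n - 1\<close>; positivity of \<open>n\<close> makes this a contradiction in spite of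
  truncated subtraction. A longer chain is cut to its first \<open>n\<close> steps.\<close>

lemma variety_dim_chain:
  assumes "variety_dim X = enat n" "n > 0"
  obtains Z where "\<And>i. i \<le> n \<Longrightarrow> irreducible_variety (Z i) \<and> Z i \<subseteq> X"
    "\<And>i. i < n \<Longrightarrow> Z i \<subset> Z (Suc i)"
proof -
  define S where "S = {n. \<exists>Z :: nat \<Rightarrow> (complex ^ 'a) set.
                 (\<forall>i\<le>n. irreducible_variety (Z i) \<and> Z i \<subseteq> X) \<and>
                 (\<forall>i<n. Z i \<subset> Z (Suc i))}"
  have dim: "variety_dim X = (SUP m \<in> S. enat m)"
    by (simp add: variety_dim_def S_def)
  have "\<exists>m\<in>S. n \<le> m"
  proof (rule ccontr)
    assume *: "\<not> ?thesis"
    have "variety_dim X \<le> enat (n - 1)"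
      unfolding dim
    proof (rule SUP_least)
      fix m assume "m \<in> S"
      then have "m \<le> n - 1" using * by fastforce
      then show "enat m \<le> enat (n - 1)" by simp
    qed
    then show False using assms by simp
  qed
  then obtain m where m: "n \<le> m" "m \<in> S" by blast
  from m(2) obtain Z where "\<forall>i\<le>m. irreducible_variety (Z i) \<and> Z i \<subseteq> X"
    "\<forall>i<m. Z i \<subset> Z (Suc i)" unfolding S_def by blast
  then show ?thesis using that[of Z] m(1) by auto
qed

lemma variety_dim_independent:
  fixes X :: "(complex ^ 'v::finite) set"
  assumes "variety_dim X = enat (CARD('n))"
  obtains f :: "'n::finite \<Rightarrow> 'v cpoly" where "independent_on f X"
proof -
  obtain Z where Z: "\<And>i. i \<le> CARD('n) \<Longrightarrow> irreducible_variety (Z i) \<and> Z i \<subseteq> X"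
    "\<And>i. i < CARD('n) \<Longrightarrow> Z i \<subset> Z (Suc i)"
    using variety_dim_chain[OF assms] by auto
  then obtain f :: "'n \<Rightarrow> 'v cpoly" where "independent_on f (Z (CARD('n)))"
    using chain_independent[where Z = Z and 'n = 'n] by blast
  moreover have "vanishing_ideal X \<subseteq> vanishing_ideal (Z (CARD('n)))"
    using Z(1)[of "CARD('n)"] by (auto simp: vanishing_ideal_def)
  ultimately show ?thesis using that unfolding independent_on_def by blast
qed

subsection \<open>Extension of complex points along algebra generators\<close>

text \<open>Subrings are sets inside one fixed ring and are studied modulo the ideal
  \<open>Z\<close> of that ring. No quotient type is needed, and generators can be adjoined one by
  one without changing the type.\<close>

definition is_subring :: "'r::comm_ring_1 set \<Rightarrow> bool" where
  "is_subring A \<longleftrightarrow> 1 \<in> A \<and> (\<forall>a\<in>A. - a \<in> A) \<and> (\<forall>a\<in>A. \<forall>b\<in>A. a + b \<in> A \<and> a * b \<in> A)"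

definition is_prime_ideal :: "'r::comm_ring_1 set \<Rightarrow> bool" where
  "is_prime_ideal Z \<longleftrightarrow> 0 \<in> Z \<and> 1 \<notin> Z \<and> (\<forall>a\<in>Z. \<forall>b\<in>Z. a + b \<in> Z) \<and>
     (\<forall>a\<in>Z. \<forall>b. a * b \<in> Z) \<and> (\<forall>a b. a * b \<in> Z \<longrightarrow> a \<in> Z \<or> b \<in> Z)"

text \<open>A complex point of the image of \<open>A\<close> in the quotient by \<open>Z\<close>.\<close>

definition is_point :: "'r::comm_ring_1 set \<Rightarrow> 'r set \<Rightarrow> ('r \<Rightarrow> complex) \<Rightarrow> bool" where
  "is_point A Z \<phi> \<longleftrightarrow> \<phi> 1 = 1 \<and> (\<forall>a\<in>A. \<forall>b\<in>A. \<phi> (a + b) = \<phi> a + \<phi> b \<and> \<phi> (a * b) = \<phi> a * \<phi> b) \<and>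
     (\<forall>a\<in>A \<inter> Z. \<phi> a = 0)"

definition poly_over :: "'r::comm_ring_1 set \<Rightarrow> 'r poly \<Rightarrow> bool" where
  "poly_over A p \<longleftrightarrow> (\<forall>j. coeff p j \<in> A)"

definition adjoin :: "'r::comm_ring_1 set \<Rightarrow> 'r \<Rightarrow> 'r set" where
  "adjoin A x = {poly p x | p. poly_over A p}"

lemma is_subring_closed:
  assumes A: "is_subring A"
  shows "1 \<in> A" "0 \<in> A" "a \<in> A \<Longrightarrow> - a \<in> A" "a \<in> A \<Longrightarrow> b \<in> A \<Longrightarrow> a + b \<in> A"
    "a \<in> A \<Longrightarrow> b \<in> A \<Longrightarrow> a * b \<in> A" "a \<in> A \<Longrightarrow> b \<in> A \<Longrightarrow> a - b \<in> A" "a \<in> A \<Longrightarrow> a ^ n \<in> A"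
proof -
  show *: "1 \<in> A" "a \<in> A \<Longrightarrow> - a \<in> A" "a \<in> A \<Longrightarrow> b \<in> A \<Longrightarrow> a + b \<in> A"
    "a \<in> A \<Longrightarrow> b \<in> A \<Longrightarrow> a * b \<in> A" for a b
    using A by (auto simp: is_subring_def)
  show "0 \<in> A" using *(3)[OF *(1) *(2)[OF *(1)]] by simp
  show "a \<in> A \<Longrightarrow> b \<in> A \<Longrightarrow> a - b \<in> A" using *(3)[OF _ *(2)] by fastforce
  show "a \<in> A \<Longrightarrow> a ^ n \<in> A" by (induction n) (auto simp: *)
qed

context
  fixes A :: "'r::comm_ring_1 set"
  assumes A: "is_subring A"
begin

lemmas subring_closed = is_subring_closed[OF A]

lemma subring_sum: "(\<And>i. i \<in> I \<Longrightarrow> f i \<in> A) \<Longrightarrow> (\<Sum>i\<in>I. f i) \<in> A"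
  by (induction I rule: infinite_finite_induct) (auto simp: subring_closed)

lemma poly_over_closed:
  shows "poly_over A 1" "poly_over A 0" "poly_over A p \<Longrightarrow> poly_over A (- p)"
    "poly_over A p \<Longrightarrow> poly_over A q \<Longrightarrow> poly_over A (p + q)"
    "poly_over A p \<Longrightarrow> poly_over A q \<Longrightarrow> poly_over A (p - q)"
    "poly_over A p \<Longrightarrow> poly_over A q \<Longrightarrow> poly_over A (p * q)"
    "c \<in> A \<Longrightarrow> poly_over A p \<Longrightarrow> poly_over A (smult c p)"
    "c \<in> A \<Longrightarrow> poly_over A (monom c n)" "c \<in> A \<Longrightarrow> poly_over A [:c:]"
  by (auto simp: poly_over_def subring_closed coeff_mult subring_sum coeff_pCons
      split: nat.splits)

lemma adjoin_subring: "is_subring (adjoin A x)"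
  unfolding is_subring_def adjoin_def
  by (auto intro: poly_over_closed simp flip: poly_minus poly_add poly_mult)
    (metis poly_1 poly_over_closed(1))

lemma adjoin_superset: "A \<subseteq> adjoin A x"
proof
  fix a assume "a \<in> A"
  then have "poly [:a:] x \<in> adjoin A x" unfolding adjoin_def using poly_over_closed(9) by blast
  then show "a \<in> adjoin A x" by simp
qed

lemma adjoin_gen: "x \<in> adjoin A x"
proof -
  have "poly (monom 1 1) x \<in> adjoin A x"
    unfolding adjoin_def using poly_over_closed(8)[of 1 1] subring_closed(1) by blast
  then show ?thesis by (simp add: poly_monom)
qed

text \<open>Leading coefficients are not invertible, so each division step costs a factor
  \<open>coeff s d\<close>. The bounds \<open>d\<close> and \<open>n\<close> stand in for degrees,
  because later only coefficients outside \<open>Z\<close> count as nonzero. The bound on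
  \<open>q\<close> is what later places its degree below that of a minimal relation.\<close>

lemma pseudo_division:
  assumes s: "poly_over A s" "\<And>j. j > d \<Longrightarrow> coeff s j = 0"
    and p: "poly_over A p" "\<And>j. j \<ge> n \<Longrightarrow> coeff p j = 0"
  obtains k q r where "poly_over A q" "poly_over A r"
    "smult (coeff s d ^ k) p = q * s + r"
    "\<And>j. j \<ge> d \<Longrightarrow> coeff r j = 0" "\<And>j. j + d \<ge> n \<Longrightarrow> coeff q j = 0"
proof -
  have "\<exists>k q r. poly_over A q \<and> poly_over A r \<and> smult (coeff s d ^ k) p = q * s + r \<and>
     (\<forall>j\<ge>d. coeff r j = 0) \<and> (\<forall>j. j + d \<ge> n \<longrightarrow> coeff q j = 0)"
    using p
  proof (induction n arbitrary: p)
    case 0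
    then have "p = 0" by (auto intro: poly_eqI)
    then show ?case
      by (intro exI[of _ 0] exI[of _ "0 :: 'r poly"]) (auto simp: poly_over_closed)
  next
    case (Suc n)
    show ?case
    proof (cases "n < d")
      case True
      then show ?thesis using Suc.prems
        by (intro exI[of _ 0] exI[of _ "0 :: 'r poly"] exI[of _ p]) (auto simp: poly_over_closed)
    next
      case False
      let ?a = "coeff s d" and ?c = "coeff p n"
      let ?m = "monom ?c (n - d)"
      let ?p = "smult ?a p - ?m * s"
      have aA: "?a \<in> A" "?c \<in> A" using s(1) Suc.prems(1) by (auto simp: poly_over_def)
      have "poly_over A ?p"
        using s(1) Suc.prems(1) aA by (auto intro!: poly_over_closed)
      moreover have "coeff ?p j = 0" if "j \<ge> n" for j
      proof (cases "j = n")
        case True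
        then show ?thesis using False by (simp add: coeff_monom_mult)
      next
        case j: False
        then have "coeff p j = 0" "coeff s (j - (n - d)) = 0"
          using Suc.prems(2)[of j] s(2)[of "j - (n - d)"] False that by auto
        then show ?thesis by (simp add: coeff_monom_mult)
      qed
      ultimately obtain k q r where kqr: "poly_over A q" "poly_over A r" "smult (?a ^ k) ?p = q * s + r"
         "\<And>j. j \<ge> d \<Longrightarrow> coeff r j = 0" "\<And>j. j + d \<ge> n \<Longrightarrow> coeff q j = 0"
        using Suc.IH[of ?p] by blast
      have "smult (?a ^ Suc k) p = (q + smult (?a ^ k) ?m) * s + r"
        using kqr(3) by (simp add: algebra_simps smult_diff_right)
      moreover have "poly_over A (q + smult (?a ^ k) ?m)"
        using kqr(1) aA by (intro poly_over_closed subring_closed)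
      moreover have "coeff (q + smult (?a ^ k) ?m) j = 0" if "j + d \<ge> Suc n" for j
        using kqr(5)[of j] that False by auto
      ultimately show ?thesis using kqr by blast
    qed
  qed
  then show ?thesis using that by blast
qed

context
  fixes Z :: "'r set"
  assumes Z: "is_prime_ideal Z"
begin

lemma ideal_closed:
  shows "0 \<in> Z" "1 \<notin> Z" "a \<in> Z \<Longrightarrow> - a \<in> Z" "a \<in> Z \<Longrightarrow> b \<in> Z \<Longrightarrow> a + b \<in> Z"
    "a \<in> Z \<Longrightarrow> a * c \<in> Z" "a \<in> Z \<Longrightarrow> c * a \<in> Z" "a \<in> Z \<Longrightarrow> b \<in> Z \<Longrightarrow> a - b \<in> Z"
    "a * c \<in> Z \<Longrightarrow> a \<in> Z \<or> c \<in> Z"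
proof -
  show *: "0 \<in> Z" "1 \<notin> Z" "a \<in> Z \<Longrightarrow> b \<in> Z \<Longrightarrow> a + b \<in> Z" "a \<in> Z \<Longrightarrow> a * c \<in> Z"
    "a * c \<in> Z \<Longrightarrow> a \<in> Z \<or> c \<in> Z" for a b c
    using Z by (auto simp: is_prime_ideal_def)
  show neg: "a \<in> Z \<Longrightarrow> - a \<in> Z" for a using *(4)[of a "- 1"] by simp
  show "a \<in> Z \<Longrightarrow> c * a \<in> Z" using *(4)[of a c] by (simp add: mult.commute)
  show "a \<in> Z \<Longrightarrow> b \<in> Z \<Longrightarrow> a - b \<in> Z" using *(3)[OF _ neg] by fastforce
qed

lemma ideal_sum: "(\<And>i. i \<in> I \<Longrightarrow> f i \<in> Z) \<Longrightarrow> (\<Sum>i\<in>I. f i) \<in> Z"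
  by (induction I rule: infinite_finite_induct) (auto simp: ideal_closed)

lemma ideal_power: "a ^ k \<in> Z \<Longrightarrow> a \<in> Z"
  by (induction k) (auto simp: ideal_closed(2) dest: ideal_closed(8))

lemma ideal_poly: "(\<And>j. coeff p j \<in> Z) \<Longrightarrow> poly p x \<in> Z"
  unfolding poly_altdef by (intro ideal_sum ideal_closed(5))

lemma poly_truncate:
  assumes "poly_over A p" "\<And>j. j \<ge> n \<Longrightarrow> coeff p j = 0" "coeff p i \<notin> Z"
  obtains d q where "d < n" "poly_over A q" "coeff q d \<notin> Z" "\<And>j. j > d \<Longrightarrow> coeff q j = 0"
    "poly p x - poly q x \<in> Z"
proof -
  have "\<exists>d q. d < n \<and> poly_over A q \<and> coeff q d \<notin> Z \<and> (\<forall>j>d. coeff q j = 0) \<and> poly p x - poly q x \<in> Z"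
    using assms
  proof (induction n arbitrary: p)
    case 0
    then show ?case using ideal_closed(1) by force
  next
    case (Suc n)
    show ?case
    proof (cases "coeff p n \<in> Z")
      case False
      have "coeff p j = 0" if "j > n" for j using Suc.prems(2) that by simp
      then show ?thesis using False Suc.prems ideal_closed(1)
        by (intro exI[of _ n] exI[of _ p]) auto
    next
      case True
      let ?p = "p - monom (coeff p n) n"
      have "poly_over A ?p" using Suc.prems(1) by (intro poly_over_closed) (auto simp: poly_over_def)
      moreover have "coeff ?p j = 0" if "j \<ge> n" for j
        using that Suc.prems(2)[of j] by (cases "j = n") auto
      moreover have "i \<noteq> n" using True Suc.prems(3) by auto
      then have "coeff ?p i \<notin> Z" using Suc.prems(3) by simp
      ultimately obtain d q where dq: "d < n" "poly_over A q" "coeff q d \<notin> Z" "\<forall>j>d. coeff q j = 0"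
          "poly ?p x - poly q x \<in> Z"
        using Suc.IH[of ?p] by blast
      have "poly p x - poly q x = (poly ?p x - poly q x) + coeff p n * x ^ n"
        by (simp add: poly_monom)
      also have "\<dots> \<in> Z" by (rule ideal_closed(4)[OF dq(5) ideal_closed(5)[OF True]])
      finally show ?thesis using dq less_SucI by blast
    qed
  qed
  then show ?thesis using that by blast
qed

text \<open>\<open>\<phi>\<close> is a homomorphism on \<open>A\<close> only, so the rules for sums,
  products and multiples require coefficients in \<open>A\<close>.\<close>

lemma point_map_poly:
  assumes \<phi>: "is_point A Z \<phi>"
  shows "coeff (map_poly \<phi> p) j = \<phi> (coeff p j)" "\<phi> 0 = 0"
    "poly_over A p \<Longrightarrow> poly_over A q \<Longrightarrow> map_poly \<phi> (p + q) = map_poly \<phi> p + map_poly \<phi> q"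
    "poly_over A p \<Longrightarrow> poly_over A q \<Longrightarrow> map_poly \<phi> (p * q) = map_poly \<phi> p * map_poly \<phi> q"
    "c \<in> A \<Longrightarrow> poly_over A p \<Longrightarrow> map_poly \<phi> (smult c p) = smult (\<phi> c) (map_poly \<phi> p)"
    "c \<in> A \<Longrightarrow> \<phi> (c ^ n) = \<phi> c ^ n"
proof -
  show 0: "\<phi> 0 = 0" using \<phi> subring_closed(2) ideal_closed(1) by (auto simp: is_point_def)
  show coeff: "coeff (map_poly \<phi> p) j = \<phi> (coeff p j)" for p j
    using 0 by (simp add: coeff_map_poly)
  have sum: "\<phi> (\<Sum>i\<in>I. f i) = (\<Sum>i\<in>I. \<phi> (f i))" if "\<And>i. f i \<in> A" for f :: "nat \<Rightarrow> 'r" and I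
    using that
  proof (induction I rule: infinite_finite_induct)
    case (insert i I)
    then show ?case using \<phi> by (simp add: is_point_def subring_sum)
  qed (auto simp: 0)
  show "map_poly \<phi> (p + q) = map_poly \<phi> p + map_poly \<phi> q" if "poly_over A p" "poly_over A q"
    using that \<phi> by (intro poly_eqI) (simp add: coeff is_point_def poly_over_def)
  show "map_poly \<phi> (p * q) = map_poly \<phi> p * map_poly \<phi> q" if "poly_over A p" "poly_over A q"
    using that \<phi> by (intro poly_eqI) (simp add: coeff coeff_mult sum poly_over_def subring_closed is_point_def)
  show "c \<in> A \<Longrightarrow> poly_over A p \<Longrightarrow> map_poly \<phi> (smult c p) = smult (\<phi> c) (map_poly \<phi> p)"
    using \<phi> by (intro poly_eqI) (simp add: coeff is_point_def poly_over_def)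
  show "\<phi> (c ^ n) = \<phi> c ^ n" if "c \<in> A"
    using that \<phi> by (induction n) (auto simp: is_point_def subring_closed)
qed

text \<open>Two polynomials representing the same element of \<open>adjoin A x\<close> differ by one
  that vanishes at \<open>x\<close>, so \<open>wd\<close> makes the value at \<xi> independent of
  the chosen representative.\<close>

lemma point_extend:
  assumes \<phi>: "is_point A Z \<phi>"
    and wd: "\<And>p. poly_over A p \<Longrightarrow> poly p x \<in> Z \<Longrightarrow> poly (map_poly \<phi> p) \<xi> = 0"
  obtains \<psi> where "is_point (adjoin A x) Z \<psi>" "\<And>p. poly_over A p \<Longrightarrow> \<psi> (poly p x) = poly (map_poly \<phi> p) \<xi>"
proof -
  define \<psi> where "\<psi> r = poly (map_poly \<phi> (SOME p. poly_over A p \<and> poly p x = r)) \<xi>" for r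
  have \<psi>: "\<psi> (poly p x) = poly (map_poly \<phi> p) \<xi>" if p: "poly_over A p" for p
  proof -
    define q where "q = (SOME q. poly_over A q \<and> poly q x = poly p x)"
    have q: "poly_over A q \<and> poly q x = poly p x"
      unfolding q_def by (rule someI_ex) (use p in blast)
    have "poly (map_poly \<phi> (p - q)) \<xi> = 0"
      using p q by (intro wd poly_over_closed) (auto simp: ideal_closed)
    moreover have "map_poly \<phi> p = map_poly \<phi> (p - q) + map_poly \<phi> q"
      using point_map_poly(3)[OF \<phi>, of "p - q" q] p q by (simp add: poly_over_closed)
    ultimately show ?thesis unfolding \<psi>_def using q_def by simp
  qed
  have "is_point (adjoin A x) Z \<psi>"
    unfolding is_point_def
  proof (intro conjI ballI)
    show "\<psi> 1 = 1"
      using \<psi>[OF poly_over_closed(1)] \<phi> by (simp add: is_point_def point_map_poly(2)[OF \<phi>])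
    fix a b assume "a \<in> adjoin A x" "b \<in> adjoin A x"
    then obtain p q where pq: "poly_over A p" "a = poly p x" "poly_over A q" "b = poly q x"
      by (auto simp: adjoin_def)
    then show "\<psi> (a + b) = \<psi> a + \<psi> b"
      using \<psi>[OF poly_over_closed(4)[OF pq(1,3)]] by (simp add: \<psi> point_map_poly[OF \<phi>])
    show "\<psi> (a * b) = \<psi> a * \<psi> b"
      using \<psi>[OF poly_over_closed(6)[OF pq(1,3)]] pq by (simp add: \<psi> point_map_poly[OF \<phi>])
  next
    fix a assume "a \<in> adjoin A x \<inter> Z"
    then show "\<psi> a = 0" using \<psi> wd by (auto simp: adjoin_def)
  qed
  then show ?thesis using that \<psi> by blast
qed

text \<open>If \<open>x\<close> is transcendental over \<open>A\<close> modulo \<open>Z\<close>, it can be sent anywhere, and a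
  coefficient of \<open>b\<close> outside \<open>Z\<close> controls \<open>b\<close>. If \<open>x\<close> is algebraic, it goes to a root of a polynomial \<open>p\<close> of
  least degree, and \<open>b\<close> divides a nonzero element of \<open>A\<close> (found as a polynomial of least degree
  in the ideal of \<open>A[x]\<close> generated by \<open>b\<close>).\<close>

lemma point_extend_adjoin:
  assumes b: "b \<in> adjoin A x" "b \<notin> Z"
  obtains a where "a \<in> A" "a \<notin> Z"
    "\<And>\<phi>. is_point A Z \<phi> \<Longrightarrow> \<phi> a \<noteq> 0 \<Longrightarrow>
       \<exists>\<psi>. is_point (adjoin A x) Z \<psi> \<and> (\<forall>c\<in>A. \<psi> c = \<phi> c) \<and> \<psi> b \<noteq> 0"
proof -
  obtain qb where qb: "poly_over A qb" "b = poly qb x" using b(1) by (auto simp: adjoin_def)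
  have const: "\<psi> c = \<phi> c" if "is_point A Z \<phi>" "c \<in> A"
    "\<And>p. poly_over A p \<Longrightarrow> \<psi> (poly p x) = poly (map_poly \<phi> p) \<xi>" for \<phi> \<psi> \<xi> c
    using that(3)[OF poly_over_closed(9)[OF that(2)]]
    by (simp add: map_poly_pCons point_map_poly(2)[OF that(1)])
  show ?thesis
  \<comment> \<open>The condition says that \<open>x\<close> is transcendental over \<open>A\<close>
    modulo \<open>Z\<close>.\<close>
  proof (cases "\<forall>p. poly_over A p \<and> poly p x \<in> Z \<longrightarrow> (\<forall>j. coeff p j \<in> Z)")
    case True
    obtain k where k: "coeff qb k \<notin> Z" using ideal_poly[of qb x] qb b(2) by blast
    show ?thesis
    proof (rule that[of "coeff qb k"])
      show "coeff qb k \<in> A" using qb by (simp add: poly_over_def)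
      show "coeff qb k \<notin> Z" by (fact k)
      fix \<phi> assume \<phi>: "is_point A Z \<phi>" "\<phi> (coeff qb k) \<noteq> 0"
      have "coeff (map_poly \<phi> qb) k \<noteq> 0" using \<phi> point_map_poly(1)[OF \<phi>(1)] by simp
      then have "map_poly \<phi> qb \<noteq> 0" by auto
      then have "finite {t. poly (map_poly \<phi> qb) t = 0}" by (rule poly_roots_finite)
      then obtain \<xi> where \<xi>: "poly (map_poly \<phi> qb) \<xi> \<noteq> 0"
        using ex_new_if_finite[OF infinite_UNIV_char_0] by blast
      have "poly (map_poly \<phi> p) \<xi> = 0" if "poly_over A p" "poly p x \<in> Z" for p
      proof -
        have "\<phi> (coeff p j) = 0" for j
          using True that \<phi>(1) by (auto simp: is_point_def poly_over_def)
        then have "map_poly \<phi> p = 0" by (intro poly_eqI) (simp add: point_map_poly[OF \<phi>(1)])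
        then show ?thesis by simp
      qed
      from point_extend[OF \<phi>(1) this] obtain \<psi> where \<psi>: "is_point (adjoin A x) Z \<psi>"
        "\<And>p. poly_over A p \<Longrightarrow> \<psi> (poly p x) = poly (map_poly \<phi> p) \<xi>" by blast
      then show "\<exists>\<psi>. is_point (adjoin A x) Z \<psi> \<and> (\<forall>c\<in>A. \<psi> c = \<phi> c) \<and> \<psi> b \<noteq> 0"
        using const[OF \<phi>(1)] \<xi> qb by metis
    qed
  next
    case False
    then obtain p i where p: "poly_over A p" "poly p x \<in> Z" "coeff p i \<notin> Z" by blast
    \<comment> \<open>\<open>good\<close> describes relations for \<open>x\<close> of degree exactly
      \<open>d\<close> modulo \<open>Z\<close>; \<open>inb\<close> describes polynomials whose value
      at \<open>x\<close> is, modulo \<open>Z\<close>, a multiple of \<open>b\<close> in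
      \<open>A[x]\<close>; \<open>goodb\<close> adds the exact degree.\<close>
    define good where "good d p \<longleftrightarrow> poly_over A p \<and> poly p x \<in> Z \<and> coeff p d \<notin> Z \<and>
      (\<forall>j>d. coeff p j = 0)" for d p
    define inb where "inb s \<longleftrightarrow> poly_over A s \<and> (\<exists>t. poly_over A t \<and> poly s x - b * poly t x \<in> Z)" for s
    define goodb where "goodb d s \<longleftrightarrow> inb s \<and> coeff s d \<notin> Z \<and> (\<forall>j>d. coeff s j = 0)" for d s
    have "\<exists>d p. good d p"
    proof -
      obtain d q where "d < Suc (degree p)" "poly_over A q" "coeff q d \<notin> Z" "\<And>j. j > d \<Longrightarrow> coeff q j = 0"
        "poly p x - poly q x \<in> Z"
        by (rule poly_truncate[OF p(1) _ p(3), of "Suc (degree p)"]) (auto simp: coeff_eq_0)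
      moreover from this have "poly q x \<in> Z"
        using ideal_closed(7)[OF p(2), of "poly p x - poly q x"] by simp
      ultimately show ?thesis unfolding good_def by blast
    qed
    then obtain d0 where "\<exists>p. good d0 p" and min0: "\<And>d p. d < d0 \<Longrightarrow> \<not> good d p"
      using exists_least_iff[of "\<lambda>d. \<exists>p. good d p"] by blast
    then obtain p0 where "good d0 p0" by blast
    then have p0: "poly_over A p0" "poly p0 x \<in> Z" "coeff p0 d0 \<notin> Z" "\<And>j. j > d0 \<Longrightarrow> coeff p0 j = 0"
      by (auto simp: good_def)
    \<comment> \<open>Minimality of \<open>d0\<close>: a relation of smaller degree has all its
      coefficients in \<open>Z\<close>.\<close>
    have small: "coeff r j \<in> Z" if "poly_over A r" "poly r x \<in> Z" "\<And>j. j \<ge> d0 \<Longrightarrow> coeff r j = 0" for r j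
    proof (rule ccontr)
      assume "coeff r j \<notin> Z"
      from poly_truncate[OF that(1,3) this, of d0 x]
      obtain d q where "d < d0" "poly_over A q" "coeff q d \<notin> Z" "\<And>j. j > d \<Longrightarrow> coeff q j = 0"
        "poly r x - poly q x \<in> Z" by auto
      moreover from this have "poly q x \<in> Z"
        using ideal_closed(7)[OF that(2), of "poly r x - poly q x"] by simp
      ultimately show False using min0 unfolding good_def by blast
    qed
    have "d0 \<noteq> 0"
    proof
      assume "d0 = 0"
      then have "p0 = [:coeff p0 0:]" using p0(4) by (intro poly_eqI) (auto simp: coeff_pCons split: nat.splits)
      then have "poly p0 x = coeff p0 0" by (metis poly_const_conv)
      then show False using p0 \<open>d0 = 0\<close> by simp
    qed
    \<comment> \<open>The value of \<open>p0\<close> at \<open>x\<close> is the multiple 0 of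
      \<open>b\<close> modulo \<open>Z\<close>, so the minimal degree \<open>d1\<close> for
      multiples of \<open>b\<close> is at most \<open>d0\<close>.\<close>
    have "goodb d0 p0"
      unfolding goodb_def inb_def using p0 poly_over_closed(2) by (auto intro!: exI[of _ 0])
    then obtain d1 s1 where s1': "goodb d1 s1" and min1: "\<And>d p. d < d1 \<Longrightarrow> \<not> goodb d p"
      using exists_least_iff[of "\<lambda>d. \<exists>p. goodb d p"] by blast
    have "d1 \<le> d0" using min1 \<open>goodb d0 p0\<close> not_le by blast
    obtain t1 where s1: "poly_over A s1" "poly_over A t1" "poly s1 x - b * poly t1 x \<in> Z"
      "coeff s1 d1 \<notin> Z" "\<And>j. j > d1 \<Longrightarrow> coeff s1 j = 0"
      using s1' by (auto simp: goodb_def inb_def)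
    have smallb: "poly r x \<in> Z \<and> coeff r j \<in> Z" if "inb r" "\<And>j. j \<ge> d1 \<Longrightarrow> coeff r j = 0" for r j
    proof -
      have "coeff r j \<in> Z" for j
      proof (rule ccontr)
        assume nj: "coeff r j \<notin> Z"
        note r' = that(1)
        have r: "poly_over A r" using r' by (simp add: inb_def)
        from poly_truncate[OF r that(2) nj, of d1 x]
        obtain d q where dq: "d < d1" "poly_over A q" "coeff q d \<notin> Z" "\<And>j. j > d \<Longrightarrow> coeff q j = 0"
          "poly r x - poly q x \<in> Z" by auto
        obtain t where t: "poly_over A t" "poly r x - b * poly t x \<in> Z"
          using r' by (auto simp: inb_def)
        have "poly q x - b * poly t x \<in> Z"
          using ideal_closed(7)[OF t(2) dq(5)] by simp
        then have "goodb d q" unfolding goodb_def inb_def using dq t by blast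
        then show False using min1 dq(1) by blast
      qed
      then show ?thesis using ideal_poly by blast
    qed
    have lc: "coeff s1 d1 ^ k \<in> A" "coeff s1 d1 ^ k \<notin> Z" for k
      using s1(1,4) ideal_power by (auto intro!: subring_closed simp: poly_over_def)
    \<comment> \<open>Otherwise \<open>p0\<close> is divided by \<open>s1\<close>. The remainder is
      again a multiple of \<open>b\<close>, of degree below \<open>d1\<close>, hence trivial modulo
      \<open>Z\<close>; so the product of the values of \<open>q\<close> and \<open>s1\<close> lies
      in \<open>Z\<close>, and primality leaves two cases.\<close>
    have "d1 = 0"
    proof (rule ccontr)
      assume d1: "d1 \<noteq> 0"
      obtain k q r where kqr: "poly_over A q" "poly_over A r" "smult (coeff s1 d1 ^ k) p0 = q * s1 + r"
        "\<And>j. j \<ge> d1 \<Longrightarrow> coeff r j = 0" "\<And>j. j + d1 \<ge> Suc d0 \<Longrightarrow> coeff q j = 0"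
        by (rule pseudo_division[OF s1(1,5) p0(1), of d1 "Suc d0"]) (use p0(4) in auto)
      have ev: "poly r x = coeff s1 d1 ^ k * poly p0 x - poly q x * poly s1 x"
        using arg_cong[OF kqr(3), of "\<lambda>p. poly p x"] by simp
      have "poly r x - b * poly (- (q * t1)) x
          = coeff s1 d1 ^ k * poly p0 x - poly q x * (poly s1 x - b * poly t1 x)"
        by (simp add: ev algebra_simps)
      also have "\<dots> \<in> Z" by (rule ideal_closed(7)[OF ideal_closed(6)[OF p0(2)] ideal_closed(6)[OF s1(3)]])
      finally have "inb r" unfolding inb_def
        using kqr(2) poly_over_closed(3)[OF poly_over_closed(6)[OF kqr(1) s1(2)]] by blast
      note r = smallb[OF this kqr(4)]
      have "poly q x * poly s1 x = coeff s1 d1 ^ k * poly p0 x - poly r x" using ev by simp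
      also have "\<dots> \<in> Z" by (rule ideal_closed(7)[OF ideal_closed(6)[OF p0(2)] conjunct1[OF r]])
      finally consider "poly q x \<in> Z" | "poly s1 x \<in> Z" using ideal_closed(8) by blast
      then show False
      proof cases
        case 1
        \<comment> \<open>As \<open>d1\<close> is positive, \<open>q\<close> has degree below
          \<open>d0\<close>, so it is trivial; then the leading coefficient of the multiple of
          \<open>p0\<close> would lie in \<open>Z\<close>.\<close>
        have "coeff q j \<in> Z" for j
          by (rule small[OF kqr(1) 1]) (use kqr(5) d1 in auto)
        then have "coeff (q * s1) d0 + coeff r d0 \<in> Z"
          unfolding coeff_mult using r by (intro ideal_closed(4) ideal_sum ideal_closed(5)) auto
        then have "coeff s1 d1 ^ k * coeff p0 d0 \<in> Z"
          using arg_cong[OF kqr(3), of "\<lambda>p. coeff p d0"] by simp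
        then show False using lc(2)[of k] p0(3) ideal_closed(8) by blast
      next
        case 2
        have "d1 = d0"
        proof (rule ccontr)
          assume "d1 \<noteq> d0"
          then have "coeff s1 d1 \<in> Z"
            using \<open>d1 \<le> d0\<close> s1 by (intro small[OF s1(1) 2]) auto
          then show False using s1 by blast
        qed
        \<comment> \<open>Now \<open>s1\<close> is itself a relation for \<open>x\<close>. The
          remainder of \<open>qb\<close> then represents \<open>b\<close> times a factor outside
          \<open>Z\<close>, and minimality of \<open>d1\<close> puts it in \<open>Z\<close>.\<close>
        obtain k q r where kqr: "poly_over A q" "poly_over A r" "smult (coeff s1 d1 ^ k) qb = q * s1 + r"
          "\<And>j. j \<ge> d1 \<Longrightarrow> coeff r j = 0"
          by (rule pseudo_division[OF s1(1,5) qb(1), of d1 "Suc (degree qb)"]) (auto simp: coeff_eq_0)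
        have ev: "poly r x = coeff s1 d1 ^ k * b - poly q x * poly s1 x"
          using arg_cong[OF kqr(3), of "\<lambda>p. poly p x"] qb by simp
        have "poly r x - b * poly [:coeff s1 d1 ^ k:] x = - (poly q x * poly s1 x)"
          by (simp add: ev algebra_simps)
        also have "\<dots> \<in> Z" by (rule ideal_closed(3)[OF ideal_closed(6)[OF 2]])
        finally have "inb r" unfolding inb_def using kqr(2) poly_over_closed(9)[OF lc(1)] by blast
        from smallb[OF this kqr(4)] have "poly r x \<in> Z" by blast
        then have "poly r x + poly q x * poly s1 x \<in> Z" by (rule ideal_closed(4)[OF _ ideal_closed(6)[OF 2]])
        then have "coeff s1 d1 ^ k * b \<in> Z" using ev by simp
        then show False using lc(2)[of k] b(2) ideal_closed(8) by blast
      qed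
    qed
    define c where "c = coeff s1 0"
    have c: "c \<in> A" "c \<notin> Z" using s1 \<open>d1 = 0\<close> by (auto simp: c_def poly_over_def)
    have "s1 = [:c:]"
      using s1(5) \<open>d1 = 0\<close> by (intro poly_eqI) (auto simp: coeff_pCons c_def split: nat.splits)
    then have ct: "c - b * poly t1 x \<in> Z" using s1(3) by simp
    have p0A: "coeff p0 d0 \<in> A" using p0(1) by (simp add: poly_over_def)
    \<comment> \<open>The first factor keeps the specialised \<open>p0\<close> nonconstant, so that
      it has a root. The second equals \<open>b\<close> times the value of \<open>t1\<close> modulo
      \<open>Z\<close>, so its nonvanishing forces that of \<open>b\<close>.\<close>
    show ?thesis
    proof (rule that[of "coeff p0 d0 * c"])
      show "coeff p0 d0 * c \<in> A" using p0A c subring_closed by blast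
      show "coeff p0 d0 * c \<notin> Z" using p0(3) c(2) ideal_closed(8) by blast
      fix \<phi> assume \<phi>: "is_point A Z \<phi>" "\<phi> (coeff p0 d0 * c) \<noteq> 0"
      then have nz: "\<phi> (coeff p0 d0) \<noteq> 0" "\<phi> c \<noteq> 0"
        using p0A c(1) by (auto simp: is_point_def)
      have "coeff (map_poly \<phi> p0) d0 \<noteq> 0" using nz point_map_poly(1)[OF \<phi>(1)] by simp
      then have "degree (map_poly \<phi> p0) \<noteq> 0" using \<open>d0 \<noteq> 0\<close> le_degree by fastforce
      then obtain \<xi> where \<xi>: "poly (map_poly \<phi> p0) \<xi> = 0"
        using Fundamental_Theorem_Algebra.fundamental_theorem_of_algebra[of "map_poly \<phi> p0"] by (auto simp: constant_degree)
      \<comment> \<open>Dividing any relation \<open>s\<close> by \<open>p0\<close> leaves a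
        remainder with coefficients in \<open>Z\<close>, which \<phi> kills. At the root \<xi> only
        a nonzero multiple of the specialised \<open>s\<close> survives.\<close>
      have wd: "poly (map_poly \<phi> s) \<xi> = 0" if s: "poly_over A s" "poly s x \<in> Z" for s
      proof -
        obtain k q r where kqr: "poly_over A q" "poly_over A r" "smult (coeff p0 d0 ^ k) s = q * p0 + r"
          "\<And>j. j \<ge> d0 \<Longrightarrow> coeff r j = 0"
          by (rule pseudo_division[OF p0(1,4) s(1), of d0 "Suc (degree s)"]) (auto simp: coeff_eq_0)
        have "poly r x = coeff p0 d0 ^ k * poly s x - poly q x * poly p0 x"
          using arg_cong[OF kqr(3), of "\<lambda>p. poly p x"] by simp
        also have "\<dots> \<in> Z" by (rule ideal_closed(7)[OF ideal_closed(6)[OF s(2)] ideal_closed(6)[OF p0(2)]])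
        finally have "coeff r j \<in> Z" for j using small kqr(2,4) by blast
        then have "\<phi> (coeff r j) = 0" for j
          using \<phi>(1) kqr(2) by (auto simp: is_point_def poly_over_def)
        then have "map_poly \<phi> r = 0" by (intro poly_eqI) (simp add: point_map_poly[OF \<phi>(1)])
        moreover have "smult (\<phi> (coeff p0 d0) ^ k) (map_poly \<phi> s) = map_poly \<phi> q * map_poly \<phi> p0 + map_poly \<phi> r"
          using arg_cong[OF kqr(3), of "map_poly \<phi>"] kqr(1,2) p0(1) p0A s(1)
          by (simp add: point_map_poly(3-)[OF \<phi>(1)] poly_over_closed subring_closed)
        ultimately have "\<phi> (coeff p0 d0) ^ k * poly (map_poly \<phi> s) \<xi> = 0"
          using \<xi> by (metis add.right_neutral mult_zero_right poly_mult poly_smult)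
        then show ?thesis using nz by simp
      qed
      from point_extend[OF \<phi>(1) wd] obtain \<psi> where \<psi>: "is_point (adjoin A x) Z \<psi>"
        "\<And>p. poly_over A p \<Longrightarrow> \<psi> (poly p x) = poly (map_poly \<phi> p) \<xi>" by blast
      have t1: "poly t1 x \<in> adjoin A x" using s1(2) by (auto simp: adjoin_def)
      note sub = is_subring_closed[OF adjoin_subring]
      have "\<psi> b * \<psi> (poly t1 x) = \<psi> (b * poly t1 x) + \<psi> (c - b * poly t1 x)"
      proof -
        have "c - b * poly t1 x \<in> adjoin A x \<inter> Z"
          using ct sub(6)[OF subsetD[OF adjoin_superset c(1)] sub(5)[OF b(1) t1]] by blast
        then show ?thesis using \<psi>(1) b(1) t1 by (auto simp: is_point_def)
      qed
      also have "\<dots> = \<psi> c"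
      proof -
        have "b * poly t1 x \<in> adjoin A x" "c - b * poly t1 x \<in> adjoin A x"
          by (rule sub(5)[OF b(1) t1], rule sub(6)[OF subsetD[OF adjoin_superset c(1)] sub(5)[OF b(1) t1]])
        then have "\<psi> (b * poly t1 x + (c - b * poly t1 x)) = \<psi> (b * poly t1 x) + \<psi> (c - b * poly t1 x)"
          using \<psi>(1) by (auto simp only: is_point_def)
        then show ?thesis by simp
      qed
      also have "\<dots> \<noteq> 0" using const[OF \<phi>(1) c(1) \<psi>(2)] nz by simp
      finally have "\<psi> b \<noteq> 0" by auto
      then show "\<exists>\<psi>. is_point (adjoin A x) Z \<psi> \<and> (\<forall>c\<in>A. \<psi> c = \<phi> c) \<and> \<psi> b \<noteq> 0"
        using \<psi> const[OF \<phi>(1) _ \<psi>(2)] by blast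
    qed
  qed
qed

end

end

subsection \<open>The generic image of an irreducible variety\<close>

lemma is_prime_vanishing_ideal:
  assumes "irreducible_variety X"
  shows "is_prime_ideal (vanishing_ideal X)"
  unfolding is_prime_ideal_def
proof (intro conjI ballI allI impI)
  show "1 \<notin> vanishing_ideal X"
    using assms by (auto simp: vanishing_ideal_def poly_eval_ring irreducible_variety_def)
  show "a \<in> vanishing_ideal X \<or> b \<in> vanishing_ideal X" if "a * b \<in> vanishing_ideal X" for a b
    by (rule vanishing_ideal_prime[OF assms that])
qed (auto simp: vanishing_ideal_def poly_eval_ring)

lemma subring_prod: "is_subring A \<Longrightarrow> (\<And>i. i \<in> I \<Longrightarrow> f i \<in> A) \<Longrightarrow> (\<Prod>i\<in>I. f i) \<in> A"
  by (induction I rule: infinite_finite_induct) (auto simp: is_subring_closed)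

lemma subring_generated_UNIV:
  assumes A: "is_subring A" and c: "\<And>c. pconst c \<in> A" and v: "\<And>i. pvar i \<in> A"
  shows "p \<in> A"
proof -
  have "psubst pconst pvar p \<in> A"
    unfolding psubst_def
    by (rule subring_sum[OF A], rule is_subring_closed(5)[OF A c],
        rule subring_prod[OF A], rule is_subring_closed(7)[OF A v])
  then show ?thesis by (simp add: psubst_pconst_pvar)
qed

text \<open>An algebraic form of Chevalley's theorem: the points of \<open>A\<close> that lift to
  points of \<open>B\<close> with \<open>b\<close> nonzero contain the basic open set of some
  \<open>a\<close> outside \<open>Z\<close>.\<close>

definition generically_extends :: "'r::comm_ring_1 set \<Rightarrow> 'r set \<Rightarrow> 'r set \<Rightarrow> 'r \<Rightarrow> bool" where
  "generically_extends Z A B b \<longleftrightarrow> (\<exists>a\<in>A - Z. \<forall>\<phi>. is_point A Z \<phi> \<and> \<phi> a \<noteq> 0 \<longrightarrow>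
     (\<exists>\<psi>. is_point B Z \<psi> \<and> (\<forall>c\<in>A. \<psi> c = \<phi> c) \<and> \<psi> b \<noteq> 0))"

text \<open>The element guarding the second extension is the one kept nonzero by the first. This is
  how nonvanishing travels down the tower of generators.\<close>

lemma generically_extends_trans:
  assumes "generically_extends Z A B b'" "A \<subseteq> B"
    "\<And>\<phi>. is_point B Z \<phi> \<Longrightarrow> \<phi> b' \<noteq> 0 \<Longrightarrow>
      \<exists>\<psi>. is_point C Z \<psi> \<and> (\<forall>c\<in>B. \<psi> c = \<phi> c) \<and> \<psi> b \<noteq> 0"
  shows "generically_extends Z A C b"
proof -
  obtain a where a: "a \<in> A - Z" "\<And>\<phi>. is_point A Z \<phi> \<Longrightarrow> \<phi> a \<noteq> 0 \<Longrightarrow>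
       \<exists>\<psi>. is_point B Z \<psi> \<and> (\<forall>c\<in>A. \<psi> c = \<phi> c) \<and> \<psi> b' \<noteq> 0"
    using assms(1) unfolding generically_extends_def by blast
  have "\<exists>\<psi>. is_point C Z \<psi> \<and> (\<forall>c\<in>A. \<psi> c = \<phi> c) \<and> \<psi> b \<noteq> 0"
    if \<phi>: "is_point A Z \<phi>" "\<phi> a \<noteq> 0" for \<phi>
  proof -
    obtain \<psi> where \<psi>: "is_point B Z \<psi>" "\<forall>c\<in>A. \<psi> c = \<phi> c" "\<psi> b' \<noteq> 0"
      using a(2)[OF \<phi>] by blast
    obtain \<psi>' where \<psi>': "is_point C Z \<psi>'" "\<forall>c\<in>B. \<psi>' c = \<psi> c" "\<psi>' b \<noteq> 0"
      using assms(3)[OF \<psi>(1,3)] by blast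
    have "\<forall>c\<in>A. \<psi>' c = \<phi> c" using \<psi>(2) \<psi>'(2) assms(2) by auto
    then show ?thesis using \<psi>'(1,3) by (intro exI[of _ \<psi>']) simp
  qed
  then show ?thesis unfolding generically_extends_def using a(1) by blast
qed

lemma point_extend_vars:
  fixes Z :: "'v::finite cpoly set"
  assumes A: "is_subring A" and Z: "is_prime_ideal Z" and S: "finite S"
  shows "\<exists>B. is_subring B \<and> A \<subseteq> B \<and> pvar ` S \<subseteq> B \<and> (\<forall>b\<in>B - Z. generically_extends Z A B b)"
  using S
proof (induction S)
  case empty
  have "generically_extends Z A A b" if "b \<in> A - Z" for b
    unfolding generically_extends_def using that by (intro bexI[of _ b]) auto
  then show ?case by (intro exI[of _ A]) (use A in auto)
next
  case (insert v S)
  then obtain B where B: "is_subring B" "A \<subseteq> B" "pvar ` S \<subseteq> B"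
    and ext: "\<forall>b\<in>B - Z. generically_extends Z A B b" by blast
  let ?B = "adjoin B (pvar v)"
  have sup: "B \<subseteq> ?B" by (rule adjoin_superset[OF B(1)])
  have "generically_extends Z A ?B b" if b: "b \<in> ?B" "b \<notin> Z" for b
  proof (rule point_extend_adjoin[OF B(1) Z b])
    fix b' assume b': "b' \<in> B" "b' \<notin> Z"
      "\<And>\<phi>. is_point B Z \<phi> \<Longrightarrow> \<phi> b' \<noteq> 0 \<Longrightarrow>
        \<exists>\<psi>. is_point ?B Z \<psi> \<and> (\<forall>c\<in>B. \<psi> c = \<phi> c) \<and> \<psi> b \<noteq> 0"
    have "generically_extends Z A B b'" using ext b'(1,2) by blast
    then show ?thesis using B(2) b'(3) by (rule generically_extends_trans)
  qed
  moreover have "pvar ` insert v S \<subseteq> ?B" using B sup adjoin_gen[OF B(1)] by auto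
  ultimately show ?case
    using B(2) sup adjoin_subring[OF B(1)] by (intro exI[of _ ?B]) auto
qed

text \<open>Independence makes the subring generated by the \<open>f i\<close> a polynomial ring, so
  every \<xi> defines a complex point of it. Where \<open>g\<close> is nonzero this point extends to
  all polynomials, and the values of the variables are the coordinates of the required
  \<open>x\<close>.\<close>

lemma independent_generic_image:
  fixes X :: "(complex ^ 'v::finite) set" and f :: "'n::finite \<Rightarrow> 'v cpoly"
  assumes X: "irreducible_variety X" and f: "independent_on f X" and h: "h \<notin> vanishing_ideal X"
  obtains g where "g \<noteq> 0"
    "\<And>\<xi>. poly_eval g \<xi> \<noteq> 0 \<Longrightarrow> \<exists>x\<in>X. (\<chi> i. poly_eval (f i) x) = \<xi> \<and> poly_eval h x \<noteq> 0"
proof -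
  let ?Z = "vanishing_ideal X" and ?\<sigma> = "psubst pconst f"
  note Z = is_prime_vanishing_ideal[OF X]
  note \<sigma> = ring_hom_psubst[OF ring_hom_pconst, of f]
  let ?A = "range ?\<sigma>"
  have A: "is_subring ?A"
    unfolding is_subring_def by (auto simp flip: ring_hom_funD[OF \<sigma>])
  obtain B where B: "is_subring B" "?A \<subseteq> B" "range pvar \<subseteq> B" and
    ext: "\<forall>b\<in>B - ?Z. generically_extends ?Z ?A B b"
    using point_extend_vars[OF A Z finite_class.finite_UNIV] by blast
  have const: "?\<sigma> (pconst c) = pconst c" and var: "?\<sigma> (pvar i) = f i" for c i
    by (simp_all add: psubst_pconst[OF ring_hom_pconst] psubst_pvar[OF ring_hom_pconst])
  have "pconst c \<in> B" for c using B(2) const[of c] by (metis rangeI subsetD)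
  then have BU: "p \<in> B" for p
    using subring_generated_UNIV[OF B(1)] B(3) by blast
  obtain g where g: "?\<sigma> g \<notin> ?Z" and
    lift: "\<And>\<phi>. is_point ?A ?Z \<phi> \<Longrightarrow> \<phi> (?\<sigma> g) \<noteq> 0 \<Longrightarrow>
       (\<exists>\<psi>. is_point B ?Z \<psi> \<and> (\<forall>c\<in>?A. \<psi> c = \<phi> c) \<and> \<psi> h \<noteq> 0)"
    using ext BU h unfolding generically_extends_def by blast
  show ?thesis
  proof (rule that)
    show "g \<noteq> 0"
      using g by (auto simp: ring_hom_funD[OF \<sigma>] vanishing_ideal_def poly_eval_ring)
    fix \<xi> assume \<xi>: "poly_eval g \<xi> \<noteq> 0"
    have inj: "p = q" if "?\<sigma> p = ?\<sigma> q" for p q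
    proof -
      have "?\<sigma> (p - q) \<in> ?Z"
        using that by (simp add: ring_hom_funD[OF \<sigma>] vanishing_ideal_def poly_eval_ring)
      then show ?thesis using f unfolding independent_on_def by (metis eq_iff_diff_eq_0)
    qed
    \<comment> \<open>Injectivity of the substitution makes this inverse legitimate: \<phi> sends
      each \<open>f i\<close> to the \<open>i\<close>-th coordinate of \<xi>.\<close>
    define \<phi> where "\<phi> r = poly_eval (inv ?\<sigma> r) \<xi>" for r
    have "inj ?\<sigma>" using inj by (auto simp: inj_def)
    then have \<phi>: "\<phi> (?\<sigma> p) = poly_eval p \<xi>" for p by (simp add: \<phi>_def)
    have "is_point ?A ?Z \<phi>"
      unfolding is_point_def
    proof (intro conjI ballI)
      show "\<phi> 1 = 1" using \<phi>[of 1] by (simp add: ring_hom_funD[OF \<sigma>] poly_eval_ring)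
    next
      fix a b assume "a \<in> ?A" "b \<in> ?A"
      then obtain p q where "a = ?\<sigma> p" "b = ?\<sigma> q" by blast
      then show "\<phi> (a + b) = \<phi> a + \<phi> b" "\<phi> (a * b) = \<phi> a * \<phi> b"
        using \<phi>[of "p + q"] \<phi>[of "p * q"] by (simp_all add: \<phi> ring_hom_funD[OF \<sigma>] poly_eval_ring)
    next
      fix a assume "a \<in> ?A \<inter> ?Z"
      then obtain p where "a = ?\<sigma> p" "?\<sigma> p \<in> ?Z" by blast
      then have "p = 0" using f by (simp add: independent_on_def)
      with \<open>a = ?\<sigma> p\<close> have "a = ?\<sigma> 0" by simp
      then show "\<phi> a = 0" using \<phi>[of 0] by (simp add: poly_eval_ring)
    qed
    then obtain \<psi> where \<psi>: "is_point B ?Z \<psi>" "\<And>p. \<psi> (?\<sigma> p) = \<phi> (?\<sigma> p)" "\<psi> h \<noteq> 0"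
      using lift[of \<phi>] \<xi> \<phi> by auto
    have hom: "ring_hom_fun \<psi>" using \<psi>(1) BU by (simp add: is_point_def ring_hom_fun_def)
    define x where "x = (\<chi> v. \<psi> (pvar v))"
    have c: "\<psi> (pconst c) = c" for c using \<psi>(2)[of "pconst c"] \<phi>[of "pconst c"] by (simp add: const)
    have ev: "poly_eval p x = \<psi> p" for p
      using ring_hom_compose_psubst[OF hom, of pconst pvar p]
      by (simp add: psubst_pconst_pvar c x_def poly_eval_lambda)
    obtain P where P: "X = {z. \<forall>p\<in>P. poly_eval p z = 0}"
      using X by (auto simp: irreducible_variety_def algebraic_set_def)
    have "\<psi> p = 0" if "p \<in> P" for p
    proof -
      have "p \<in> ?Z" using that P by (auto simp: vanishing_ideal_def)
      then show ?thesis using \<psi>(1) BU by (auto simp: is_point_def)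
    qed
    then have "x \<in> X" by (simp add: P ev)
    moreover have "(\<chi> i. poly_eval (f i) x) = \<xi>"
      by (simp add: vec_eq_iff ev) (metis \<phi> \<psi>(2) poly_eval_pvar var)
    ultimately show "\<exists>x\<in>X. (\<chi> i. poly_eval (f i) x) = \<xi> \<and> poly_eval h x \<noteq> 0"
      using \<psi>(3) ev by metis
  qed
qed

subsection \<open>Zero loci are negligible\<close>

text \<open>The indicator of the translates of \<open>S\<close> along \<open>v\<close> is integrated
  in both orders. Lines meet \<open>S\<close> in null sets, so one order gives 0; all translates
  have the measure of \<open>S\<close>, so the other gives that measure times the infinite length of
  the line.\<close>

lemma closed_negligible_lines:
  fixes S :: "'a::euclidean_space set"
  assumes S: "closed S" and lines: "\<And>x. countable {t::real. x + t *\<^sub>R v \<in> S}"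
  shows "negligible S"
proof -
  define f where "f x t = (indicator S (x + t *\<^sub>R v) :: ennreal)" for x :: 'a and t :: real
  have meas: "case_prod f \<in> borel_measurable (lborel \<Otimes>\<^sub>M lborel)"
  proof -
    have "(\<lambda>(x::'a, t::real). x + t *\<^sub>R v) \<in> borel_measurable borel"
      by (intro borel_measurable_continuous_onI) (auto intro!: continuous_intros simp: case_prod_unfold)
    then have "(\<lambda>p. indicator S (case p of (x::'a, t::real) \<Rightarrow> x + t *\<^sub>R v) :: ennreal) \<in> borel_measurable borel"
      by (rule measurable_compose) (use S in simp)
    then show ?thesis
      by (simp add: f_def case_prod_unfold borel_prod[symmetric])
  qed
  have "(\<integral>\<^sup>+ t. f x t \<partial>lborel) = 0" for x
  proof -
    have "(\<integral>\<^sup>+ t. f x t \<partial>lborel) = (\<integral>\<^sup>+ t. indicator {t. x + t *\<^sub>R v \<in> S} t \<partial>lborel)"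
      by (intro nn_integral_cong) (simp add: f_def indicator_def)
    also have "\<dots> = emeasure lborel {t. x + t *\<^sub>R v \<in> S}"
      using sets.countable[of "{t. x + t *\<^sub>R v \<in> S}" lborel, OF _ lines] by (intro nn_integral_indicator) simp
    also have "\<dots> = 0" by (rule emeasure_lborel_countable[OF lines])
    finally show ?thesis .
  qed
  then have "0 = (\<integral>\<^sup>+ x. (\<integral>\<^sup>+ t. f x t \<partial>lborel) \<partial>lborel)" by simp
  also have "\<dots> = (\<integral>\<^sup>+ t. (\<integral>\<^sup>+ x. f x t \<partial>lborel) \<partial>lborel)"
    by (rule lborel_pair.Fubini'[OF meas, symmetric])
  also have "\<dots> = (\<integral>\<^sup>+ (t::real). emeasure lborel S \<partial>lborel)"
  proof (rule nn_integral_cong)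
    fix t :: real
    have "emeasure lborel S = emeasure (distr lborel borel ((+) (t *\<^sub>R v))) S"
      by (simp add: lborel_distr_plus)
    also have "\<dots> = (\<integral>\<^sup>+ x. indicator S x \<partial>distr lborel borel ((+) (t *\<^sub>R v)))"
      using S by simp
    also have "\<dots> = (\<integral>\<^sup>+ x. f x t \<partial>lborel)"
      using S by (subst nn_integral_distr) (simp_all add: f_def add.commute)
    finally show "(\<integral>\<^sup>+ x. f x t \<partial>lborel) = emeasure lborel S" by simp
  qed
  also have "\<dots> = emeasure lborel S * \<infinity>" by simp
  finally have "emeasure lborel S = 0" by (simp add: ennreal_mult_eq_top_iff)
  then have "S \<in> null_sets lborel" using S by (simp add: null_sets_def)
  then show ?thesis by (simp add: negligible_iff_null_sets null_sets_completionI)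
qed

lemma negligible_zero_locus:
  fixes p :: "'n::finite cpoly"
  assumes "p \<noteq> 0"
  shows "negligible (zero_locus p)"
proof -
  obtain z0 where z0: "poly_eval p z0 \<noteq> 0" using poly_eval_nonzero[OF assms] by blast
  have "\<exists>U. openin (top_of_set (zero_locus p)) U \<and> z \<in> U \<and> negligible U" if z: "z \<in> zero_locus p" for z
  proof -
    have "continuous_on UNIV (\<lambda>y. poly_eval p (y + (z0 - z)))"
      by (rule continuous_on_compose2[OF continuous_on_poly_eval[of UNIV]]) (auto intro!: continuous_intros)
    moreover have "poly_eval p (z + (z0 - z)) \<noteq> 0" using z0 by simp
    \<comment> \<open>One direction serves a whole neighbourhood: from every point near
      \<open>z\<close> the step \<open>z0 - z\<close> leads off the zero locus, so no complex line
      through such a point in this direction lies in the locus.\<close>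
    ultimately obtain r where r: "r > 0" "\<And>y. y \<in> ball z r \<Longrightarrow> poly_eval p (y + (z0 - z)) \<noteq> 0"
      using continuous_on_avoid[of UNIV "\<lambda>y. poly_eval p (y + (z0 - z))" z 0] by (auto simp: dist_commute)
    \<comment> \<open>The closed ball makes the set closed; half the radius keeps it inside the open
      ball where the step avoids the zero locus.\<close>
    let ?T = "zero_locus p \<inter> cball z (r/2)"
    have "countable {t::real. x + t *\<^sub>R (z0 - z) \<in> ?T}" for x
    proof (cases "\<exists>t::real. x + t *\<^sub>R (z0 - z) \<in> ?T")
      case True
      then obtain t0 :: real where t0: "x + t0 *\<^sub>R (z0 - z) \<in> ?T" by blast
      obtain q where q: "\<And>t. poly q t = poly_eval p (\<chi> i. x $ i + t * (z0 - z) $ i)"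
        using poly_eval_line by blast
      have eq: "(\<chi> i. x $ i + complex_of_real t * (z0 - z) $ i) = x + t *\<^sub>R (z0 - z)" for t
        by (simp add: vec_eq_iff del: scaleR_conv_of_real) (simp add: scaleR_conv_of_real)
      have "x + t0 *\<^sub>R (z0 - z) \<in> ball z r" using t0 r(1) by auto
      then have "poly_eval p (x + t0 *\<^sub>R (z0 - z) + (z0 - z)) \<noteq> 0" by (rule r(2))
      then have "poly q (complex_of_real (t0 + 1)) \<noteq> 0"
        unfolding q eq by (simp add: algebra_simps)
      then have "q \<noteq> 0" by auto
      then have "finite {t. poly q t = 0}" by (rule poly_roots_finite)
      then have "finite (complex_of_real -` {t. poly q t = 0})"
        by (rule finite_vimageI) (simp add: inj_def)
      moreover have "{t::real. x + t *\<^sub>R (z0 - z) \<in> ?T} \<subseteq> complex_of_real -` {t. poly q t = 0}"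
        unfolding vimage_def mem_Collect_eq q eq by (auto simp: zero_locus_def)
      ultimately show ?thesis by (meson countable_finite finite_subset)
    next
      case False
      then have "{t::real. x + t *\<^sub>R (z0 - z) \<in> ?T} = {}" by blast
      then show ?thesis by (simp only: countable_empty)
    qed
    then have "negligible ?T"
      by (intro closed_negligible_lines) (auto intro: closed_zero_locus)
    then have "negligible (zero_locus p \<inter> ball z (r/2))"
      by (rule negligible_subset) auto
    then show ?thesis
      using z r(1) by (intro exI[of _ "zero_locus p \<inter> ball z (r/2)"]) auto
  qed
  then show ?thesis by (subst locally_negligible_alt) blast
qed

subsection \<open>Local sections and surjectivity of the projection\<close>

lemma continuous_on_proj: "continuous_on S (proj :: complex ^ ('n::finite + 'm::finite) \<Rightarrow> _)"
  unfolding proj_def by (intro continuous_intros)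

text \<open>The locus is an intersection, so a point outside it avoids one particular admissible
  \<open>A\<close>. The local inverse is the restriction of an ambient holomorphic map; hence
  \<open>s\<close> lives on an open \<open>W\<close> although only the part of \<open>W\<close> in
  the image of \<open>X\<close> is hit.\<close>

lemma local_section:
  fixes X :: "(complex ^ ('n::finite + 'm::finite)) set"
  assumes x: "x \<in> X" "proj x \<notin> discriminant_locus X"
  obtains U W s where "openin (top_of_set X) U" "x \<in> U" "open W" "holomorphic_map_on s W"
    "proj ` U = proj ` X \<inter> W" "\<And>u. u \<in> U \<Longrightarrow> s (proj u) = u"
proof -
  obtain A where A: "algebraic_set A" "proj x \<notin> A"
    and lb: "locally_biholomorphic proj (X - proj -` A) (proj ` X - A)"
    using x(2) unfolding discriminant_locus_def by blast
  let ?S = "X - proj -` A" and ?T = "proj ` X - A"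
  have "x \<in> ?S" using x A by simp
  then obtain U0 V where U0: "openin (top_of_set ?S) U0" "x \<in> U0" and V: "openin (top_of_set ?T) V"
    and bh: "biholomorphic_between proj U0 V"
    using lb unfolding locally_biholomorphic_def by blast
  then have bij: "bij_betw proj U0 V"
    and inv: "holomorphic_map_on_subset (inv_into U0 proj) V"
    by (auto simp: biholomorphic_between_def)
  have "proj x \<in> V" using bij U0 by (auto simp: bij_betw_def)
  then obtain W0 F where W0: "open W0" "proj x \<in> W0" "holomorphic_map_on F W0"
    "\<And>y. y \<in> W0 \<inter> V \<Longrightarrow> F y = inv_into U0 proj y"
    using inv unfolding holomorphic_map_on_subset_def by metis
  obtain V' where V': "open V'" "V = ?T \<inter> V'" using V by (auto simp: openin_open)
  have clA: "closed A" by (rule closed_algebraic_set[OF A(1)])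
  \<comment> \<open>Shrinking to \<open>V'\<close> and off \<open>A\<close> makes every point of the
    image of \<open>X\<close> in \<open>W\<close> a point of \<open>V\<close>; removing the closed
    \<open>A\<close> also makes openness relative to \<open>?S\<close> pass to
    \<open>X\<close>.\<close>
  define W where "W = W0 \<inter> V' \<inter> (- A)"
  define U where "U = U0 \<inter> (X \<inter> proj -` W)"
  have openW: "open W" unfolding W_def using W0 V' clA by auto
  have pre: "openin (top_of_set X) (X \<inter> proj -` W)"
    by (rule continuous_openin_preimage_gen[OF continuous_on_proj openW])
  have "openin (top_of_set X) (X \<inter> proj -` (- A))"
    by (rule continuous_openin_preimage_gen[OF continuous_on_proj]) (use clA in auto)
  moreover have "X \<inter> proj -` (- A) = ?S" by auto
  ultimately have "openin (top_of_set X) U0" using U0(1) openin_trans by metis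
  then have 1: "openin (top_of_set X) U" unfolding U_def using pre by (rule openin_Int)
  have xW: "proj x \<in> W" using W0 \<open>proj x \<in> V\<close> V' by (auto simp: W_def)
  have 2: "x \<in> U" using U0 x xW by (simp add: U_def)
  have 3: "holomorphic_map_on F W" using W0(3) by (auto simp: holomorphic_map_on_def W_def)
  have 4: "proj ` U = proj ` X \<inter> W"
  proof
    show "proj ` U \<subseteq> proj ` X \<inter> W" by (auto simp: U_def)
    show "proj ` X \<inter> W \<subseteq> proj ` U"
    proof
      fix w assume w: "w \<in> proj ` X \<inter> W"
      then have "w \<in> V" using V'(2) by (auto simp: W_def)
      then obtain u where "u \<in> U0" "w = proj u" using bij by (auto simp: bij_betw_def)
      moreover have "u \<in> X" using U0(1) \<open>u \<in> U0\<close> openin_imp_subset by fastforce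
      ultimately show "w \<in> proj ` U" using w by (auto simp: U_def)
    qed
  qed
  have 5: "F (proj u) = u" if "u \<in> U" for u
  proof -
    have "u \<in> U0" "proj u \<in> W0" "proj u \<in> V"
      using that bij by (auto simp: U_def W_def bij_betw_def)
    then show ?thesis using W0(4)[of "proj u"] bij by (simp add: bij_betw_def)
  qed
  show ?thesis by (rule that[OF 1 2 openW 3 4 5])
qed

section \<open>Differentiable polynomial maps and null images\<close>

lemma has_derivative_vec_components:
  fixes f :: "'a::real_normed_vector \<Rightarrow> ('b::euclidean_space) ^ ('k::finite)"
  assumes "\<And>i. ((\<lambda>x. f x $ i) has_derivative (\<lambda>v. f' v $ i)) F"
  shows "(f has_derivative f') F"
proof -
  have eq: "y = (\<Sum>i\<in>UNIV. axis i (y $ i))" for y :: "'b ^ 'k"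
    by (simp add: vec_eq_iff axis_def)
  have lin: "bounded_linear (axis i :: 'b \<Rightarrow> 'b ^ 'k)" for i :: 'k
    by (rule linear_conv_bounded_linear[THEN iffD1, OF linearI]) (auto simp: vec_eq_iff axis_def)
  have "((\<lambda>x. \<Sum>i\<in>UNIV. axis i (f x $ i)) has_derivative (\<lambda>v. \<Sum>i\<in>UNIV. axis i (f' v $ i))) F"
    by (intro has_derivative_sum bounded_linear.has_derivative[OF lin] assms)
  then show ?thesis by (simp flip: eq)
qed

text \<open>Polynomials with this property form a subring containing constants and
  variables.\<close>

lemma poly_eval_differentiable: "poly_eval p differentiable (at z)"
proof -
  let ?A = "{p. poly_eval p differentiable (at z)}"
  have fun_eq: "poly_eval (p + q) = (\<lambda>z. poly_eval p z + poly_eval q z)"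
    "poly_eval (p * q) = (\<lambda>z. poly_eval p z * poly_eval q z)"
    "poly_eval (- p) = (\<lambda>z. - poly_eval p z)"
    "poly_eval 1 = (\<lambda>z. 1)" "poly_eval (pconst c) = (\<lambda>z. c)" "poly_eval (pvar i) = (\<lambda>z. z $ i)"
    for p q :: "'a cpoly" and c i
    by (auto simp: poly_eval_ring)
  have "is_subring ?A"
    by (auto simp: is_subring_def fun_eq intro!: derivative_intros)
  moreover have "pconst c \<in> ?A" for c by (simp add: fun_eq)
  moreover have "pvar i \<in> ?A" for i
    by (auto simp: fun_eq intro: bounded_linear_imp_differentiable)
  ultimately show ?thesis using subring_generated_UNIV[of ?A p] by blast
qed

lemma differentiable_vec_components:
  fixes f :: "'a::real_normed_vector \<Rightarrow> ('b::euclidean_space) ^ ('k::finite)"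
  assumes "\<And>i. (\<lambda>x. f x $ i) differentiable F"
  shows "f differentiable F"
proof -
  obtain f' where "\<And>i. ((\<lambda>x. f x $ i) has_derivative f' i) F"
    using assms unfolding differentiable_def by metis
  then have "(f has_derivative (\<lambda>v. \<chi> i. f' i v)) F"
    by (intro has_derivative_vec_components) simp
  then show ?thesis unfolding differentiable_def by blast
qed

lemma closed_proj_image:
  assumes "finite_projection X"
  shows "closed (proj ` X)"
proof -
  have "closed_map (top_of_set X) euclidean proj"
    using assms by (simp add: finite_projection_def proper_map_def)
  then show ?thesis unfolding closed_map_def by (metis closed_closedin closedin_self topspace_euclidean_subtopology closedin_subtopology_refl closedin_topspace)
qed

text \<open>On a chart the map factors through \<open>proj\<close> as polynomials after a section.
  This is differentiable between spaces of equal dimension and keeps null sets null; by Lindelof,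
  countably many charts suffice.\<close>

lemma negligible_section_image:
  fixes X :: "(complex ^ ('n::finite + 'm::finite)) set" and f :: "'n \<Rightarrow> ('n + 'm) cpoly"
  assumes "negligible (proj ` X)"
  shows "negligible ((\<lambda>x. \<chi> i. poly_eval (f i) x) ` {x \<in> X. proj x \<notin> discriminant_locus X})"
    (is "negligible (?f ` ?X0)")
proof -
  let ?P = "\<lambda>U. openin (top_of_set X) U \<and> negligible (?f ` U)"
  have "\<exists>U. ?P U \<and> x \<in> U" if x: "x \<in> ?X0" for x
  proof -
    obtain U W s where U: "openin (top_of_set X) U" "x \<in> U" "open W" "holomorphic_map_on s W"
      "proj ` U = proj ` X \<inter> W" "\<And>u. u \<in> U \<Longrightarrow> s (proj u) = u"
      by (rule local_section[of x X]) (use x in auto)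
    let ?g = "\<lambda>w. \<chi> i. poly_eval (f i) (s w)"
    have "?g differentiable (at w)" if "w \<in> W" for w
    proof (rule differentiable_vec_components)
      fix i
      have "s differentiable (at w)"
        using U(4) that by (auto simp: holomorphic_map_on_def differentiable_def)
      then show "(\<lambda>w. ?g w $ i) differentiable (at w)"
        using differentiable_chain_at[OF _ poly_eval_differentiable] by (simp add: o_def)
    qed
    then have "?g differentiable_on (proj ` X \<inter> W)"
      by (auto simp: differentiable_on_def intro: differentiable_at_withinI)
    then have "negligible (?g ` (proj ` X \<inter> W))"
      by (intro negligible_differentiable_image_negligible)
        (use assms in \<open>auto intro: negligible_subset\<close>)
    moreover have "?f ` U \<subseteq> ?g ` (proj ` X \<inter> W)"
    proof
      fix y assume "y \<in> ?f ` U"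
      then obtain u where u: "u \<in> U" "y = ?f u" by blast
      then have "y = ?g (proj u)" using U(6) by simp
      moreover have "proj u \<in> proj ` X \<inter> W" using U(5) u by blast
      ultimately show "y \<in> ?g ` (proj ` X \<inter> W)" by blast
    qed
    ultimately show ?thesis using U negligible_subset by blast
  qed
  then have cover: "?X0 \<subseteq> \<Union>(Collect ?P)" by blast
  obtain \<U> where \<U>: "\<U> \<subseteq> Collect ?P" "countable \<U>" "\<Union>\<U> = \<Union>(Collect ?P)"
    using Lindelof_openin[of "Collect ?P" X] by blast
  have "negligible (\<Union>U\<in>\<U>. ?f ` U)"
    using \<U> by (intro negligible_countable_Union[of "(`) ?f ` \<U>", simplified]) auto
  then show ?thesis by (rule negligible_subset) (use cover \<U>(3) in blast)
qed

theorem proj_surjective: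
  fixes X :: "(complex ^ ('n::finite + 'm::finite)) set"
  assumes X: "irreducible_variety X" and dim: "variety_dim X = enat (CARD('n))"
    and fin: "finite_projection X" and \<delta>: "\<delta> \<noteq> 0" "discriminant_locus X \<subseteq> zero_locus \<delta>"
    and x0: "x0 \<in> X" "proj x0 \<notin> zero_locus \<delta>"
  shows "proj ` X = UNIV"
proof -
  let ?z = "\<lambda>i. pvar (Inl i) :: ('n + 'm) cpoly"
  have z: "(\<chi> i. poly_eval (?z i) x) = proj x" for x by (simp add: proj_def)
  \<comment> \<open>Points where this pullback of \<delta> is nonzero lie off the discriminant
    locus, where the local sections are.\<close>
  define h where "h = psubst pconst ?z \<delta>"
  have hev: "poly_eval h x = poly_eval \<delta> (proj x)" for x
    by (simp add: h_def poly_eval_compose z del: poly_eval_pvar)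
  have h: "h \<notin> vanishing_ideal X"
    using x0 by (auto simp: vanishing_ideal_def hev zero_locus_def)
  have ind: "independent_on ?z X"
  proof (rule ccontr)
    assume "\<not> ?thesis"
    then obtain g where g: "g \<noteq> 0" "psubst pconst ?z g \<in> vanishing_ideal X"
      by (auto simp: independent_on_def)
    have "proj ` X \<subseteq> zero_locus g"
      using g(2) by (auto simp: vanishing_ideal_def zero_locus_def poly_eval_compose z simp del: poly_eval_pvar)
    then have neg: "negligible (proj ` X)" using negligible_zero_locus[OF g(1)] negligible_subset by blast
    obtain f :: "'n \<Rightarrow> ('n + 'm) cpoly" where f: "independent_on f X"
      using variety_dim_independent[OF dim] by blast
    obtain g' where g': "g' \<noteq> 0"
      "\<And>\<xi>. poly_eval g' \<xi> \<noteq> 0 \<Longrightarrow> \<exists>x\<in>X. (\<chi> i. poly_eval (f i) x) = \<xi> \<and> poly_eval h x \<noteq> 0"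
      using independent_generic_image[OF X f h] by blast
    let ?I = "(\<lambda>x. \<chi> i. poly_eval (f i) x) ` {x \<in> X. proj x \<notin> discriminant_locus X}"
    have "UNIV \<subseteq> zero_locus g' \<union> ?I"
    proof
      fix \<xi> :: "complex ^ 'n"
      show "\<xi> \<in> zero_locus g' \<union> ?I"
      proof (cases "\<xi> \<in> zero_locus g'")
        case False
        then obtain x where x: "x \<in> X" "(\<chi> i. poly_eval (f i) x) = \<xi>" "poly_eval h x \<noteq> 0"
          using g'(2) by (auto simp: zero_locus_def)
        then have "proj x \<notin> discriminant_locus X"
          using \<delta>(2) by (auto simp: hev zero_locus_def)
        then show ?thesis using x by blast
      qed simp
    qed
    moreover have "negligible (zero_locus g' \<union> ?I)"
      using negligible_zero_locus[OF g'(1)] negligible_section_image[OF neg] by (rule negligible_Un)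
    ultimately have "negligible (UNIV :: (complex ^ 'n) set)" using negligible_subset by blast
    then show False using open_not_negligible[of "UNIV :: (complex ^ 'n) set"] by simp
  qed
  obtain g where g: "g \<noteq> 0"
    "\<And>\<xi>. poly_eval g \<xi> \<noteq> 0 \<Longrightarrow> \<exists>x\<in>X. (\<chi> i. poly_eval (?z i) x) = \<xi> \<and> poly_eval h x \<noteq> 0"
    using independent_generic_image[OF X ind h] by blast
  \<comment> \<open>With independent coordinates the missed points form a null set, which is open
    because properness makes the image closed; hence it is empty.\<close>
  have "- proj ` X \<subseteq> zero_locus g"
    using g(2) unfolding z by (force simp: zero_locus_def)
  then have "negligible (- proj ` X)" using negligible_zero_locus[OF g(1)] negligible_subset by blast
  moreover have "open (- proj ` X)" using closed_proj_image[OF fin] by auto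
  ultimately have "- proj ` X = {}" using open_not_negligible by blast
  then show ?thesis by blast
qed

subsection \<open>Components of the complement of an amoeba are convex\<close>

lemma log_map_exp: "log_map (\<chi> j. exp (w $ j)) = (\<chi> j. Re (w $ j))"
  and exp_in_torus: "(\<chi> j. exp (w $ j)) \<in> torus"
  by (simp_all add: log_map_def torus_def)

text \<open>Along a convergent sequence in the amoeba the moduli of the chosen zeros converge to
  positive numbers: bounded above, so that a subsequence converges, and away from 0, so that the
  limit stays in the torus.\<close>

lemma closed_amoeba: "closed (amoeba p)"
  unfolding closed_sequential_limits
proof (intro allI impI, elim conjE)
  fix u :: "nat \<Rightarrow> real ^ 'a" and l
  assume u: "\<forall>n. u n \<in> amoeba p" and lim: "u \<longlonglongrightarrow> l"
  then have "\<exists>z. z \<in> torus \<inter> zero_locus p \<and> u n = log_map z" for n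
    by (auto simp: amoeba_def)
  then obtain z where z: "\<And>n. z n \<in> torus \<inter> zero_locus p" "\<And>n. u n = log_map (z n)"
    by metis
  have mod: "cmod (z n $ i) = exp (u n $ i)" for n i
    using z(1)[of n] by (simp add: z(2) log_map_def torus_def)
  have limi: "(\<lambda>n. cmod (z n $ i)) \<longlonglongrightarrow> exp (l $ i)" for i
    unfolding mod by (intro tendsto_exp tendsto_vec_nth lim)
  have "\<exists>B. \<forall>n. cmod (z n $ i) \<le> B" for i
    using convergent_imp_Bseq[OF convergentI[OF limi[of i]]] by (auto simp: Bseq_def)
  then obtain B where B: "\<And>n i. cmod (z n $ i) \<le> B i" by metis
  have "norm (z n) \<le> (\<Sum>i\<in>UNIV. B i)" for n
  proof -
    have "norm (z n) \<le> (\<Sum>i\<in>UNIV. cmod (z n $ i))"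
      unfolding norm_vec_def by (rule L2_set_le_sum) simp
    also have "\<dots> \<le> (\<Sum>i\<in>UNIV. B i)" by (rule sum_mono) (rule B)
    finally show ?thesis .
  qed
  then have "bounded (range z)" by (auto simp: bounded_iff)
  then obtain a r where r: "strict_mono (r :: nat \<Rightarrow> nat)" "(z \<circ> r) \<longlonglongrightarrow> a"
    using bounded_imp_convergent_subsequence by blast
  have "cmod (a $ i) = exp (l $ i)" for i
  proof (rule LIMSEQ_unique)
    show "(\<lambda>n. cmod ((z \<circ> r) n $ i)) \<longlonglongrightarrow> cmod (a $ i)"
      by (intro tendsto_norm tendsto_vec_nth r)
    show "(\<lambda>n. cmod ((z \<circ> r) n $ i)) \<longlonglongrightarrow> exp (l $ i)"
      using LIMSEQ_subseq_LIMSEQ[OF limi r(1)] by (simp add: o_def)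
  qed
  then have "a \<in> torus" "log_map a = l"
    by (auto simp: torus_def log_map_def vec_eq_iff) (metis exp_not_eq_zero norm_zero)
  moreover have "a \<in> zero_locus p"
    by (rule closed_sequentially[OF closed_zero_locus _ r(2)]) (use z in auto)
  ultimately show "l \<in> amoeba p" unfolding amoeba_def by blast
qed

text \<open>The argument principle for polynomials: the integers are the numbers of roots inside the
  two circles, with multiplicity, found by splitting off one root at a time.\<close>

lemma contour_integral_log_deriv_poly:
  fixes P :: "complex poly"
  assumes "0 < r1" "r1 < r2" "P \<noteq> 0"
    and "\<And>w. norm w = r1 \<Longrightarrow> poly P w \<noteq> 0" "\<And>w. norm w = r2 \<Longrightarrow> poly P w \<noteq> 0"
  shows "\<exists>n1 n2. n1 \<le> n2 \<and>
     ((\<lambda>w. poly (pderiv P) w / poly P w) has_contour_integral (2 * pi * \<i> * of_nat n1)) (circlepath 0 r1) \<and>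
     ((\<lambda>w. poly (pderiv P) w / poly P w) has_contour_integral (2 * pi * \<i> * of_nat n2)) (circlepath 0 r2) \<and>
     ((\<exists>a. poly P a = 0 \<and> r1 < norm a \<and> norm a < r2) \<longrightarrow> n1 < n2)"
  using assms(3-5)
proof (induction "degree P" arbitrary: P rule: less_induct)
  case less
  \<comment> \<open>A root adds 1 to the count of each circle that encloses it, so the larger circle
    gains at least as much, and strictly more if the root lies between the circles.\<close>
  have split: "\<exists>n1 n2. n1 \<le> n2 \<and>
     ((\<lambda>w. poly (pderiv P) w / poly P w) has_contour_integral (2 * pi * \<i> * of_nat n1)) (circlepath 0 r1) \<and>
     ((\<lambda>w. poly (pderiv P) w / poly P w) has_contour_integral (2 * pi * \<i> * of_nat n2)) (circlepath 0 r2) \<and>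
     (r1 < norm a \<and> norm a < r2 \<longrightarrow> n1 < n2)" if a: "poly P a = 0" for a
  proof -
    obtain Q where Q: "P = [:-a, 1:] * Q" using a by (metis poly_eq_0_iff_dvd dvdE)
    have "Q \<noteq> 0" using Q less.prems by auto
    have "degree P = Suc (degree Q)" unfolding Q using \<open>Q \<noteq> 0\<close> by (subst degree_mult_eq) auto
    then have "degree Q < degree P" by simp
    moreover have "poly Q w \<noteq> 0" if "norm w = r1 \<or> norm w = r2" for w
      using less.prems(2,3) that unfolding Q by auto
    ultimately obtain n1 n2 where n: "n1 \<le> n2"
      "((\<lambda>w. poly (pderiv Q) w / poly Q w) has_contour_integral (2 * pi * \<i> * of_nat n1)) (circlepath 0 r1)"
      "((\<lambda>w. poly (pderiv Q) w / poly Q w) has_contour_integral (2 * pi * \<i> * of_nat n2)) (circlepath 0 r2)"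
      using less.hyps[of Q] \<open>Q \<noteq> 0\<close> by blast
    have na: "norm a \<noteq> r1" "norm a \<noteq> r2" using a less.prems by auto
    have circ: "((\<lambda>w. 1 / (w - a)) has_contour_integral
        (2 * pi * \<i> * of_nat (if norm a < r then 1 else 0))) (circlepath 0 r)"
      if r: "r > 0" "norm a \<noteq> r" for r
    proof -
      have "a \<notin> path_image (circlepath 0 r)" using r by (auto simp: path_image_circlepath)
      then have *: "((\<lambda>w. 1 / (w - a)) has_contour_integral
          (2 * pi * \<i> * winding_number (circlepath 0 r) a)) (circlepath 0 r)"
        by (intro has_contour_integral_winding_number) auto
      have "winding_number (circlepath 0 r) a = of_nat (if norm a < r then 1 else 0)"
      proof (cases "norm a < r")
        case True
        then show ?thesis using winding_number_circlepath[of a 0 r] by simp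
      next
        case False
        then have "winding_number (circlepath 0 r) a = 0"
          by (intro winding_number_zero_outside[where s = "cball 0 r"])
            (use r in \<open>auto simp: path_image_circlepath\<close>)
        then show ?thesis using False by simp
      qed
      then show ?thesis using * by simp
    qed
    have step: "((\<lambda>w. poly (pderiv P) w / poly P w) has_contour_integral
        (2 * pi * \<i> * of_nat ((if norm a < r then 1 else 0) + m))) (circlepath 0 r)"
      if "r > 0" "norm a \<noteq> r" "\<And>w. norm w = r \<Longrightarrow> poly P w \<noteq> 0"
       "((\<lambda>w. poly (pderiv Q) w / poly Q w) has_contour_integral (2 * pi * \<i> * of_nat m)) (circlepath 0 r)" for r m
    proof -
      have "((\<lambda>w. 1 / (w - a) + poly (pderiv Q) w / poly Q w) has_contour_integral
        (2 * pi * \<i> * of_nat (if norm a < r then 1 else 0) + 2 * pi * \<i> * of_nat m)) (circlepath 0 r)"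
        by (intro has_contour_integral_add circ that)
      moreover have "1 / (w - a) + poly (pderiv Q) w / poly Q w = poly (pderiv P) w / poly P w"
        if "w \<in> path_image (circlepath 0 r)" for w
      proof -
        have "poly P w \<noteq> 0"
          using that \<open>r > 0\<close> \<open>\<And>w. norm w = r \<Longrightarrow> poly P w \<noteq> 0\<close> by (auto simp: path_image_circlepath)
        then have nz: "w - a \<noteq> 0" "poly Q w \<noteq> 0" by (auto simp: Q)
        have dP: "pderiv P = Q + [:-a, 1:] * pderiv Q"
          unfolding Q pderiv_mult by (simp add: pderiv_pCons)
        have dPw: "poly (pderiv P) w = poly Q w + (w - a) * poly (pderiv Q) w"
          unfolding dP by (simp add: algebra_simps)
        have Pw: "poly P w = (w - a) * poly Q w" by (simp add: Q algebra_simps)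
        show ?thesis
          unfolding dPw Pw using nz by (simp add: add_divide_distrib)
      qed
      ultimately have "((\<lambda>w. poly (pderiv P) w / poly P w) has_contour_integral
        (2 * pi * \<i> * of_nat (if norm a < r then 1 else 0) + 2 * pi * \<i> * of_nat m)) (circlepath 0 r)"
        by (rule has_contour_integral_eq)
      then show ?thesis by (simp add: algebra_simps)
    qed
    have "((\<lambda>w. poly (pderiv P) w / poly P w) has_contour_integral
        (2 * pi * \<i> * of_nat ((if norm a < r1 then 1 else 0) + n1))) (circlepath 0 r1)"
      "((\<lambda>w. poly (pderiv P) w / poly P w) has_contour_integral
        (2 * pi * \<i> * of_nat ((if norm a < r2 then 1 else 0) + n2))) (circlepath 0 r2)"
      using assms na n less.prems by (intro step; force)+
    then show ?thesis using n(1) assms(2)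
      by (intro exI[of _ "(if norm a < r1 then 1 else 0) + n1"] exI[of _ "(if norm a < r2 then 1 else 0) + n2"] conjI)
        auto
  qed
  show ?case
  \<comment> \<open>A root in the annulus, if there is one, is split off first, since it alone
    yields the strict inequality.\<close>
  proof (cases "\<exists>a. poly P a = 0 \<and> r1 < norm a \<and> norm a < r2")
    case True
    then show ?thesis using split by meson
  next
    case no: False
    show ?thesis
    proof (cases "\<exists>a. poly P a = 0")
      case True
      then show ?thesis using split no by meson
    next
      case False
      then have "degree P = 0"
        using Fundamental_Theorem_Algebra.fundamental_theorem_of_algebra[of P] by (auto simp: constant_degree)
      then have "pderiv P = 0" by (simp add: pderiv_eq_0_iff)
      then show ?thesis using no
        by (intro exI[of _ 0]) (auto intro: has_contour_integral_0)
    qed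
  qed
qed

lemma winding_number_poly_circle_neq:
  fixes P :: "complex poly"
  assumes r: "0 < r1" "r1 < r2"
    and nz: "\<And>w. norm w = r1 \<Longrightarrow> poly P w \<noteq> 0" "\<And>w. norm w = r2 \<Longrightarrow> poly P w \<noteq> 0"
    and a: "poly P a = 0" "r1 < norm a" "norm a < r2"
  shows "winding_number (poly P \<circ> circlepath 0 r1) 0 \<noteq> winding_number (poly P \<circ> circlepath 0 r2) 0"
proof -
  have "P \<noteq> 0" using nz(1)[of "of_real r1"] r by auto
  then obtain n1 n2 where n: "n1 < n2"
     "((\<lambda>w. poly (pderiv P) w / poly P w) has_contour_integral (2 * pi * \<i> * of_nat n1)) (circlepath 0 r1)"
     "((\<lambda>w. poly (pderiv P) w / poly P w) has_contour_integral (2 * pi * \<i> * of_nat n2)) (circlepath 0 r2)"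
    using contour_integral_log_deriv_poly[OF r _ nz] a by metis
  have wn: "winding_number (poly P \<circ> circlepath 0 r) 0 = of_nat m"
    if "r > 0" "\<And>w. norm w = r \<Longrightarrow> poly P w \<noteq> 0"
     "((\<lambda>w. poly (pderiv P) w / poly P w) has_contour_integral (2 * pi * \<i> * of_nat m)) (circlepath 0 r)" for r m
  proof -
    have an: "poly P analytic_on UNIV"
      by (auto simp: analytic_on_open holomorphic_on_def field_differentiable_def intro!: exI poly_DERIV)
    have "valid_path (poly P \<circ> circlepath 0 r)"
      by (rule valid_path_compose_analytic[OF _ an]) auto
    moreover have "0 \<notin> path_image (poly P \<circ> circlepath 0 r)"
      using that by (auto simp: path_image_compose path_image_circlepath)
    ultimately have "winding_number (poly P \<circ> circlepath 0 r) 0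
      = 1 / (2 * pi * \<i>) * contour_integral (poly P \<circ> circlepath 0 r) (\<lambda>w. 1 / (w - 0))"
      by (rule winding_number_valid_path)
    also have "contour_integral (poly P \<circ> circlepath 0 r) (\<lambda>w. 1 / (w - 0))
      = contour_integral (circlepath 0 r) (\<lambda>w. deriv (poly P) w * (1 / (poly P w - 0)))"
      by (rule contour_integral_comp_analyticW[OF an]) auto
    also have "(\<lambda>w. deriv (poly P) w * (1 / (poly P w - 0))) = (\<lambda>w. poly (pderiv P) w / poly P w)"
      by (simp add: fun_eq_iff DERIV_imp_deriv[OF poly_DERIV])
    also have "contour_integral (circlepath 0 r) \<dots> = 2 * pi * \<i> * of_nat m"
      by (rule contour_integral_unique[OF that(3)])
    finally show ?thesis by (simp add: o_def)
  qed
  show ?thesis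
    using wn[OF _ nz(1) n(2)] wn[OF _ nz(2) n(3)] r n(1) by simp
qed

text \<open>Integrality of \<open>k\<close> turns \<open>p\<close>, along a complex line in
  logarithmic coordinates, into a Laurent polynomial in \<open>exp w\<close>; the factor with
  \<open>M\<close> clears negative powers.\<close>

lemma laurent_line_poly:
  fixes p :: "'n::finite cpoly" and k :: "'n \<Rightarrow> int" and c :: "complex ^ 'n"
  obtains P :: "complex poly" and M :: nat where
    "\<And>w. poly P (exp w) = exp (of_nat M * w) * poly_eval p (\<chi> j. exp (c $ j + of_int (k j) * w))"
proof -
  define s where "s e = (\<Sum>j\<in>UNIV. k j * int (Poly_Mapping.lookup e j))" for e
  \<comment> \<open>\<open>M\<close> bounds every \<open>\<bar>s e\<bar>\<close>, so all exponents
    \<open>int M + s e\<close> are nonnegative and \<open>nat\<close> loses nothing.\<close>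
  define M where "M = nat (\<Sum>e\<in>Poly_Mapping.keys p. \<bar>s e\<bar>)"
  define P where "P = (\<Sum>e\<in>Poly_Mapping.keys p.
    monom (Poly_Mapping.lookup p e * exp (\<Sum>j\<in>UNIV. of_nat (Poly_Mapping.lookup e j) * c $ j)) (nat (int M + s e)))"
  have "poly P (exp w) = exp (of_nat M * w) * poly_eval p (\<chi> j. exp (c $ j + of_int (k j) * w))" for w
  proof -
    have "poly (monom (Poly_Mapping.lookup p e * exp (\<Sum>j\<in>UNIV. of_nat (Poly_Mapping.lookup e j) * c $ j))
          (nat (int M + s e))) (exp w)
        = exp (of_nat M * w) * (Poly_Mapping.lookup p e *
            (\<Prod>j\<in>UNIV. ((\<chi> j. exp (c $ j + of_int (k j) * w)) $ j) ^ Poly_Mapping.lookup e j))"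
      if e: "e \<in> Poly_Mapping.keys p" for e
    proof -
      have "\<bar>s e\<bar> \<le> (\<Sum>e\<in>Poly_Mapping.keys p. \<bar>s e\<bar>)"
        using e by (intro member_le_sum) auto
      then have "int M + s e \<ge> 0" unfolding M_def by linarith
      then have nat: "complex_of_nat (nat (int M + s e)) = of_nat M + of_int (s e)"
        by (metis of_int_add of_int_of_nat_eq of_nat_nat)
      have "(\<Prod>j\<in>UNIV. ((\<chi> j. exp (c $ j + of_int (k j) * w)) $ j) ^ Poly_Mapping.lookup e j)
          = exp (\<Sum>j\<in>UNIV. of_nat (Poly_Mapping.lookup e j) * (c $ j + of_int (k j) * w))"
        by (simp add: exp_sum exp_of_nat_mult)
      also have "(\<Sum>j\<in>UNIV. of_nat (Poly_Mapping.lookup e j) * (c $ j + of_int (k j) * w))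
          = (\<Sum>j\<in>UNIV. of_nat (Poly_Mapping.lookup e j) * c $ j) + of_int (s e) * w"
        by (simp add: s_def sum.distrib sum_distrib_left algebra_simps)
      finally show ?thesis
        by (simp add: poly_monom nat exp_add algebra_simps flip: exp_of_nat_mult)
    qed
    then show ?thesis
      by (simp add: P_def poly_sum poly_eval_def sum_distrib_left)
  qed
  then show ?thesis using that by blast
qed

text \<open>A zero over the inner point gives the univariate \<open>P\<close> a root between the
  circles of radii 1 and \<open>exp T\<close>, so \<open>P\<close> winds differently along them. A
  path in \<open>F\<close> from \<open>u\<close> to \<open>v\<close> deforms one image loop into the
  other away from 0, which is impossible.\<close>

lemma amoeba_complement_integer_segment:
  fixes p :: "'n::finite cpoly" and k :: "'n \<Rightarrow> int"
  assumes F: "path_connected F" "F \<inter> amoeba p = {}"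
    and u: "u \<in> F" and v: "v \<in> F" "v = (\<chi> j. u $ j + of_int (k j) * T)"
    and s: "0 < s" "s < T"
  shows "(\<chi> j. u $ j + of_int (k j) * s) \<notin> amoeba p"
proof
  assume "(\<chi> j. u $ j + of_int (k j) * s) \<in> amoeba p"
  then obtain z where z: "z \<in> torus" "z \<in> zero_locus p" "log_map z = (\<chi> j. u $ j + of_int (k j) * s)"
    by (auto simp: amoeba_def)
  define a where "a j = Arg (z $ j)" for j
  have zexp: "z $ j = exp (of_real (u $ j + of_int (k j) * s) + \<i> * of_real (a j))" for j
  proof -
    have "z $ j \<noteq> 0" using z(1) by (simp add: torus_def)
    moreover have "ln (cmod (z $ j)) = u $ j + of_int (k j) * s"
      using z(3) by (simp add: log_map_def vec_eq_iff)
    ultimately have "cmod (z $ j) = exp (u $ j + of_int (k j) * s)"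
      using exp_ln[of "cmod (z $ j)"] by simp
    then show ?thesis
      using Arg_eq[OF \<open>z $ j \<noteq> 0\<close>] by (simp only: a_def exp_add exp_of_real)
  qed
  \<comment> \<open>For imaginary \<theta> the point of evaluation lies over \<open>x\<close>, with
    the arguments of \<open>z\<close> turned by \<open>k j\<close> times the imaginary part of
    \<theta>.\<close>
  define L where "L x \<theta> = poly_eval p (\<chi> j. exp (of_real (x $ j) + \<i> * of_real (a j) + of_int (k j) * \<theta>))"
    for x :: "real ^ 'n" and \<theta> :: complex
  have Lnz: "L x \<theta> \<noteq> 0" if "x \<in> F" "Re \<theta> = 0" for x \<theta>
  proof
    assume L0: "L x \<theta> = 0"
    define y where "y = (\<chi> j. of_real (x $ j) + \<i> * of_real (a j) + of_int (k j) * \<theta>)"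
    have "(\<chi> j. exp (y $ j)) \<in> zero_locus p"
      using L0 by (simp add: L_def y_def zero_locus_def)
    then have "log_map (\<chi> j. exp (y $ j)) \<in> amoeba p"
      unfolding amoeba_def using exp_in_torus[of y] by blast
    moreover have "log_map (\<chi> j. exp (y $ j)) = x"
      unfolding log_map_exp y_def using that(2) by (simp add: vec_eq_iff)
    ultimately show False using F(2) that(1) by auto
  qed
  obtain P :: "complex poly" and M :: nat where P:
    "\<And>w. poly P (exp w) = exp (of_nat M * w) *
      poly_eval p (\<chi> j. exp ((\<chi> j. of_real (u $ j) + \<i> * of_real (a j)) $ j + of_int (k j) * w))"
    using laurent_line_poly by blast
  have PL: "poly P (exp (of_real t + \<theta>)) = exp (of_nat M * (of_real t + \<theta>)) * L (\<chi> j. u $ j + of_int (k j) * t) \<theta>"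
    for t \<theta>
    unfolding P L_def by (simp add: algebra_simps)
  have Pcirc: "poly P w \<noteq> 0" if t: "(\<chi> j. u $ j + of_int (k j) * t) \<in> F" and w: "norm w = exp t" for t w
  proof -
    have "w \<noteq> 0" using w by auto
    have weq: "exp (of_real t + \<i> * of_real (Arg w)) = w"
      using Arg_eq[OF \<open>w \<noteq> 0\<close>] w by (simp add: exp_add exp_of_real)
    have "L (\<chi> j. u $ j + of_int (k j) * t) (\<i> * of_real (Arg w)) \<noteq> 0" by (rule Lnz[OF t]) simp
    then show ?thesis using PL[of t "\<i> * of_real (Arg w)"] unfolding weq by simp
  qed
  have u0: "(\<chi> j. u $ j + of_int (k j) * 0) = u" by (simp add: vec_eq_iff)
  have "winding_number (poly P \<circ> circlepath 0 1) 0 \<noteq> winding_number (poly P \<circ> circlepath 0 (exp T)) 0"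
  proof (rule winding_number_poly_circle_neq)
    show "poly P w \<noteq> 0" if "norm w = 1" for w
      using Pcirc[of 0 w] u that u0 by simp
    show "poly P w \<noteq> 0" if "norm w = exp T" for w
      using Pcirc[of T w] v that by simp
    have zeq: "(\<chi> j. exp (of_real (u $ j + of_int (k j) * s) + \<i> * of_real (a j))) = z"
      by (simp only: vec_eq_iff vec_lambda_beta zexp) simp
    have "L (\<chi> j. u $ j + of_int (k j) * s) 0 = poly_eval p z"
      unfolding L_def vec_lambda_beta mult_zero_right add_0_right zeq ..
    then have "L (\<chi> j. u $ j + of_int (k j) * s) 0 = 0" using z(2) by (simp add: zero_locus_def)
    then show "poly P (exp (of_real s)) = 0" using PL[of s 0] by simp
  qed (use s in \<open>auto simp: norm_exp_eq_Re\<close>)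
  moreover have "homotopic_loops (- {0}) (poly P \<circ> circlepath 0 1) (poly P \<circ> circlepath 0 (exp T))"
  proof -
    obtain g where g: "path g" "path_image g \<subseteq> F" "pathstart g = u" "pathfinish g = v"
      using F(1) u v(1) unfolding path_connected_def by blast
    have gF: "g t \<in> F" if "t \<in> {0..1}" for t using g(2) that by (auto simp: path_image_def)
    have gcont: "continuous_on {0..1} g" using g(1) by (simp add: path_def)
    define \<theta> where "\<theta> x = 2 * of_real pi * \<i> * of_real x" for x :: real
    \<comment> \<open>The homotopy follows \<open>g\<close> inside \<open>F\<close>, because the
      straight segment is not yet known to avoid the amoeba. At both ends it is \<open>P\<close>
      along a circle.\<close>
    define h where "h = (\<lambda>(t, x). exp (of_nat M * (of_real (t * T) + \<theta> x)) * L (g t) (\<theta> x))"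
    have circ: "circlepath 0 (exp r) x = exp (of_real r + \<theta> x)" for r x
      by (simp add: circlepath \<theta>_def exp_add exp_of_real)
    show ?thesis
      unfolding homotopic_loops
    proof (intro exI[of _ h] conjI ballI)
      have g': "continuous_on ({0..1} \<times> {0..1::real}) (\<lambda>y. g (fst y))"
        by (rule continuous_on_compose2[OF gcont]) (auto intro!: continuous_intros)
      have "continuous_on ({0..1} \<times> {0..1}) (\<lambda>y. L (g (fst y)) (\<theta> (snd y)))"
        unfolding L_def
        by (rule continuous_on_compose2[OF continuous_on_poly_eval[of UNIV]])
          (auto simp: \<theta>_def intro!: continuous_intros g')
      then show "continuous_on ({0..1} \<times> {0..1}) h"
        unfolding h_def case_prod_unfold by (intro continuous_intros) (auto simp: \<theta>_def intro!: continuous_intros)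
      show "h \<in> {0..1} \<times> {0..1} \<rightarrow> - {0}"
        using Lnz gF by (auto simp: h_def \<theta>_def)
      fix x :: real assume "x \<in> {0..1}"
      show "h (0, x) = (poly P \<circ> circlepath 0 1) x"
        using PL[of 0 "\<theta> x"] circ[of 0 x] g(3) u0 by (simp add: h_def pathstart_def)
      show "h (1, x) = (poly P \<circ> circlepath 0 (exp T)) x"
        using PL[of T "\<theta> x"] circ[of T x] g(4) v(2) by (simp add: h_def pathfinish_def)
    next
      fix t :: real
      \<comment> \<open>The intermediate loops close up because \<open>k\<close> and
        \<open>M\<close> are integral.\<close>
      have per: "exp (y + of_int n * \<theta> 1) = exp y" for y n
        using exp_plus_2pin[of y n] by (simp add: \<theta>_def mult_ac)
      have "exp (of_nat M * (y + \<theta> 1)) = exp (of_nat M * y)" for y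
        using per[of "of_nat M * y" "int M"] by (simp add: distrib_left)
      moreover have "\<theta> 0 = 0" by (simp add: \<theta>_def)
      ultimately show "pathfinish (h \<circ> Pair t) = pathstart (h \<circ> Pair t)"
        by (simp add: h_def pathstart_def pathfinish_def L_def per)
    qed
  qed
  ultimately show False using winding_number_homotopic_loops by metis
qed

lemma amoeba_complement_component_convex:
  fixes p :: "'n::finite cpoly"
  assumes F: "F \<in> components (- amoeba p)"
  shows "open F" "convex F"
proof -
  have op: "open (- amoeba p)" using closed_amoeba by auto
  show oF: "open F" using open_components[OF op F] .
  have conn: "connected F" and sub: "F \<subseteq> - amoeba p"
    using in_components_connected[OF F] in_components_subset[OF F] .
  have pc: "path_connected F" using connected_open_path_connected[OF oF conn] .
  show "convex F"
    unfolding convex_contains_segment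
  proof (intro ballI)
    fix u v assume uv: "u \<in> F" "v \<in> F"
    have "q \<notin> amoeba p" if "q \<in> closed_segment u v" for q
    proof -
      obtain t where t: "0 \<le> t" "t \<le> 1" "q = (1 - t) *\<^sub>R u + t *\<^sub>R v"
        using \<open>q \<in> closed_segment u v\<close> by (auto simp: closed_segment_def)
      show ?thesis
      proof (cases "t = 0 \<or> t = 1")
        case True
        then show ?thesis using t(3) uv sub by auto
      next
        case False
        obtain e1 where e1: "e1 > 0" "ball u e1 \<subseteq> F" using oF uv(1) open_contains_ball by blast
        obtain e2 where e2: "e2 > 0" "ball v e2 \<subseteq> F" using oF uv(2) open_contains_ball by blast
        define e where "e = min e1 e2"
        have e: "e > 0" "ball u e \<subseteq> F" "ball v e \<subseteq> F" using e1 e2 by (auto simp: e_def)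
        \<comment> \<open>Rounding \<open>Q\<close> times the difference vector to integers moves
          each coordinate of the difference by at most \<open>1 / Q\<close>, hence the vector by
          less than \<open>e\<close>.\<close>
        obtain Q :: nat where Q: "real CARD('n) / e < real Q" using reals_Archimedean2 by blast
        then have Q0: "Q > 0" using e(1) by (metis divide_pos_pos gr0I of_nat_0 of_nat_0_less_iff less_asym zero_less_card_finite)
        define k where "k j = \<lfloor>real Q * (v - u) $ j\<rfloor>" for j
        define \<kappa> :: "real ^ 'n" where "\<kappa> = (\<chi> j. of_int (k j) / real Q)"
        have "norm (v - u - \<kappa>) \<le> (\<Sum>j\<in>UNIV. \<bar>(v - u - \<kappa>) $ j\<bar>)" by (rule norm_le_l1_cart)
        also have "\<dots> \<le> (\<Sum>j\<in>(UNIV::'n set). 1 / real Q)"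
        proof (rule sum_mono)
          fix j
          have "(v - u - \<kappa>) $ j = (real Q * (v - u) $ j - of_int (k j)) / real Q"
            using Q0 by (simp add: \<kappa>_def field_simps)
          moreover have "\<bar>real Q * (v - u) $ j - of_int (k j)\<bar> \<le> 1" unfolding k_def by linarith
          ultimately show "\<bar>(v - u - \<kappa>) $ j\<bar> \<le> 1 / real Q" using Q0 by (simp add: divide_right_mono)
        qed
        also have "\<dots> < e" using Q Q0 e(1) by (simp add: field_simps)
        finally have close: "norm (v - u - \<kappa>) < e" .
        \<comment> \<open>The new endpoints differ by the rational vector \<kappa>, and
          \<open>q\<close> divides their segment in the old ratio \<open>t\<close>; so integrality
          is gained without moving \<open>q\<close>.\<close>
        define u' v' where "u' = q - t *\<^sub>R \<kappa>" and "v' = q + (1 - t) *\<^sub>R \<kappa>"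
        have "u' - u = t *\<^sub>R (v - u - \<kappa>)" by (simp add: u'_def t(3) algebra_simps)
        then have "norm (u' - u) \<le> norm (v - u - \<kappa>)" using t by (simp add: mult_left_le_one_le)
        then have u': "u' \<in> F" using e(2) close by (auto simp: dist_norm norm_minus_commute)
        have "v' - v = (1 - t) *\<^sub>R (- (v - u - \<kappa>))" by (simp add: v'_def t(3) algebra_simps)
        then have "norm (v' - v) \<le> norm (v - u - \<kappa>)" using t by (simp add: mult_left_le_one_le norm_minus_commute)
        then have v': "v' \<in> F" using e(3) close by (auto simp: dist_norm norm_minus_commute)
        have "(\<chi> j. u' $ j + of_int (k j) * (t / real Q)) \<notin> amoeba p"
        proof (rule amoeba_complement_integer_segment[OF pc _ u' v', of _ k "1 / real Q"])
          show "v' = (\<chi> j. u' $ j + of_int (k j) * (1 / real Q))"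
            by (simp add: vec_eq_iff u'_def v'_def \<kappa>_def algebra_simps)
          show "0 < t / real Q" "t / real Q < 1 / real Q"
            using False t Q0 by (auto intro!: divide_strict_right_mono)
        qed (use sub in auto)
        moreover have "(\<chi> j. u' $ j + of_int (k j) * (t / real Q)) = q"
          by (simp add: vec_eq_iff u'_def \<kappa>_def)
        ultimately show ?thesis by simp
      qed
    qed
    then show "closed_segment u v \<subseteq> F"
      using components_maximal[OF F connected_segment, of u v] uv by auto
  qed
qed

subsection \<open>The covering over the preimage of a component\<close>

lemma finite_points_separated:
  fixes K :: "'a::metric_space set"
  assumes "finite K"
  obtains r where "r > 0" "\<And>x y. x \<in> K \<Longrightarrow> y \<in> K \<Longrightarrow> x \<noteq> y \<Longrightarrow> ball x r \<inter> ball y r = {}"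
proof -
  \<comment> \<open>The 1 keeps the minimum defined when \<open>K\<close> has at most one
    point.\<close>
  let ?D = "insert 1 ((\<lambda>(x, y). dist x y) ` {p \<in> K \<times> K. fst p \<noteq> snd p})"
  have fin: "finite ?D" using assms by simp
  have "Min ?D > 0" using fin by (subst Min_gr_iff) auto
  moreover have "ball x (Min ?D / 2) \<inter> ball y (Min ?D / 2) = {}" if "x \<in> K" "y \<in> K" "x \<noteq> y" for x y
  proof -
    have "Min ?D \<le> dist x y" using fin that by (intro Min_le) force+
    then have "False" if "dist x z < Min ?D / 2" "dist y z < Min ?D / 2" for z
      using that dist_triangle2[of x y z] by linarith
    then show ?thesis by auto
  qed
  ultimately show ?thesis using that[of "Min ?D / 2"] by simp
qed

text \<open>Disjoint charts surround the finitely many points of a fiber. The rest of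
  \<open>X\<close> is closed and misses the fiber, so its image is closed and misses
  \<open>y\<close>; over a small neighbourhood no point lies outside the charts.\<close>

lemma closed_local_homeomorphism_covering_space:
  fixes p :: "'a::real_normed_vector \<Rightarrow> 'b::real_normed_vector"
  assumes cont: "continuous_on X p" and closed: "closed_map (top_of_set X) euclidean p"
    and fin: "\<And>y. y \<in> S \<Longrightarrow> finite {x \<in> X. p x = y}"
    and S: "open S" "S \<subseteq> p ` X"
    and loc: "\<And>x. x \<in> X \<Longrightarrow> p x \<in> S \<Longrightarrow>
       \<exists>U W q. openin (top_of_set X) U \<and> x \<in> U \<and> open W \<and> homeomorphism U W p q"
  shows "covering_space (p -` S \<inter> X) p S"
proof
  let ?XS = "p -` S \<inter> X"
  show "continuous_on ?XS p" using cont by (rule continuous_on_subset) auto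
  show "p ` ?XS = S" using S(2) by auto
  fix y assume y: "y \<in> S"
  let ?K = "{x \<in> X. p x = y}"
  obtain r where r: "r > 0" "\<And>x z. x \<in> ?K \<Longrightarrow> z \<in> ?K \<Longrightarrow> x \<noteq> z \<Longrightarrow> ball x r \<inter> ball z r = {}"
    using finite_points_separated[OF fin[OF y]] by blast
  define chart where "chart x t \<longleftrightarrow> openin (top_of_set X) (fst t) \<and> x \<in> fst t \<and> open (fst (snd t)) \<and>
    homeomorphism (fst t) (fst (snd t)) p (snd (snd t))" for x t
  have "\<exists>t. chart x t" if x: "x \<in> ?K" for x
  proof -
    obtain U W q where "openin (top_of_set X) U \<and> x \<in> U \<and> open W \<and> homeomorphism U W p q"
      using loc[of x] x y by auto
    then show ?thesis by (intro exI[of _ "(U, W, q)"]) (simp add: chart_def)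
  qed
  then obtain t where t: "\<And>x. x \<in> ?K \<Longrightarrow> chart x (t x)" by metis
  define U W q where "U x = fst (t x)" and "W x = fst (snd (t x))" and "q x = snd (snd (t x))" for x
  have UWq: "openin (top_of_set X) (U x) \<and> x \<in> U x \<and> open (W x) \<and> homeomorphism (U x) (W x) p (q x)"
    if "x \<in> ?K" for x
    using t[OF that] by (simp add: chart_def U_def W_def q_def)
  define V where "V x = U x \<inter> ball x r" for x
  have V: "openin (top_of_set X) (V x)" "x \<in> V x" if "x \<in> ?K" for x
    using UWq[OF that] r(1) by (auto simp: V_def openin_Int_open)
  have Vdisj: "V x \<inter> V z = {}" if "x \<in> ?K" "z \<in> ?K" "x \<noteq> z" for x z
    using r(2)[OF that] by (auto simp: V_def)
  have Vop: "open (p ` V x)" if "x \<in> ?K" for x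
  proof -
    have "V x = U x \<inter> V x" by (auto simp: V_def)
    moreover have "openin (top_of_set (U x)) (V x)"
      unfolding V_def by (auto simp: openin_open)
    ultimately have "openin (top_of_set (W x)) (p ` V x)"
      using UWq[OF that] homeomorphism_imp_open_map by blast
    then show ?thesis using UWq[OF that] openin_open_trans by blast
  qed
  define A where "A = X - (\<Union>x\<in>?K. V x)"
  have "closedin (top_of_set X) A"
    unfolding A_def using V(1) by (intro closedin_diff openin_Union) auto
  then have "closedin euclidean (p ` A)" using closed unfolding closed_map_def by blast
  then have clA: "closed (p ` A)" by (simp only: closed_closedin)
  define T where "T = S \<inter> - p ` A \<inter> (\<Inter>x\<in>?K. p ` V x)"
  have "open T"
    unfolding T_def using S(1) clA Vop fin[OF y] by (intro open_Int open_INT) auto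
  have "y \<in> T" using y V(2) by (auto simp: T_def A_def image_iff)
  have TS: "T \<subseteq> S" by (auto simp: T_def)
  show "\<exists>T. y \<in> T \<and> openin (top_of_set S) T \<and>
          (\<exists>v. \<Union>v = ?XS \<inter> p -` T \<and> (\<forall>u\<in>v. openin (top_of_set ?XS) u) \<and>
               pairwise disjnt v \<and> (\<forall>u\<in>v. \<exists>q. homeomorphism u T p q))"
  proof (intro exI[of _ T] exI[of _ "(\<lambda>x. V x \<inter> p -` T) ` ?K"] conjI ballI)
    show "y \<in> T" by fact
    show "openin (top_of_set S) T" using \<open>open T\<close> TS by (simp add: openin_open_eq S(1))
    show "\<Union>((\<lambda>x. V x \<inter> p -` T) ` ?K) = ?XS \<inter> p -` T"
    proof
      have "V x \<subseteq> X" if "x \<in> ?K" for x using openin_imp_subset[OF V(1)[OF that]] .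
      then show "\<Union>((\<lambda>x. V x \<inter> p -` T) ` ?K) \<subseteq> ?XS \<inter> p -` T" using TS by blast
      show "?XS \<inter> p -` T \<subseteq> \<Union>((\<lambda>x. V x \<inter> p -` T) ` ?K)"
        by (auto simp: T_def A_def)
    qed
    show "pairwise disjnt ((\<lambda>x. V x \<inter> p -` T) ` ?K)"
      using Vdisj unfolding pairwise_def disjnt_def by blast
    fix u assume "u \<in> (\<lambda>x. V x \<inter> p -` T) ` ?K"
    then obtain x where x: "x \<in> ?K" "u = V x \<inter> p -` T" by blast
    have "openin (top_of_set X) (X \<inter> p -` T)"
      by (rule continuous_openin_preimage_gen[OF cont \<open>open T\<close>])
    then have "openin (top_of_set X) (V x \<inter> (X \<inter> p -` T))" using V(1)[OF x(1)] by blast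
    moreover have "V x \<inter> (X \<inter> p -` T) = u"
      using x(2) openin_imp_subset[OF V(1)[OF x(1)]] by blast
    ultimately have u: "openin (top_of_set X) u" by simp
    moreover have "u \<subseteq> ?XS" using openin_imp_subset[OF u] x(2) TS by auto
    ultimately show "openin (top_of_set ?XS) u"
      by (rule openin_subset_trans) auto
    have hom: "homeomorphism (U x) (W x) p (q x)" using UWq[OF x(1)] by blast
    have uU: "u \<subseteq> U x" using x(2) by (auto simp: V_def)
    have "p ` u = T"
    proof
      have "T \<subseteq> p ` V x" using x(1) unfolding T_def by blast
      then show "T \<subseteq> p ` u" unfolding x(2) by blast
    qed (use x(2) in auto)
    then have "homeomorphism u T p (q x)"
      using homeomorphism_of_subsets[OF hom uU] by blast
    then show "\<exists>q. homeomorphism u T p q" by blast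
  qed
qed

section \<open>The exponential over a component, and lifting along it\<close>

lemma open_torus: "open (torus :: (complex ^ 'n::finite) set)"
proof -
  have "torus = (\<Inter>i\<in>UNIV. {z :: complex ^ 'n. z $ i \<noteq> 0})" by (auto simp: torus_def)
  moreover have "open {z :: complex ^ 'n. z $ i \<noteq> 0}" for i
    by (intro open_Collect_neq continuous_intros)
  then have "open (\<Inter>i\<in>UNIV. {z :: complex ^ 'n. z $ i \<noteq> 0})" by (intro open_INT) auto
  ultimately show ?thesis by simp
qed

lemma open_log_preimage:
  assumes "open F"
  shows "open (log_preimage F)"
proof -
  have "continuous_on torus log_map"
    unfolding log_map_def by (intro continuous_intros) (auto simp: torus_def)
  then have "open (torus \<inter> log_map -` F)"
    using continuous_open_preimage[OF _ open_torus assms] by blast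
  moreover have "torus \<inter> log_map -` F = log_preimage F" by (auto simp: log_preimage_def)
  ultimately show ?thesis by simp
qed

lemma log_preimage_disjoint:
  assumes "F \<subseteq> - amoeba \<delta>"
  shows "log_preimage F \<inter> zero_locus \<delta> = {}"
  using assms by (auto simp: log_preimage_def amoeba_def)

definition exp_vec :: "complex ^ 'n \<Rightarrow> complex ^ ('n::finite)" where
  "exp_vec w = (\<chi> j. exp (w $ j))"

definition tube :: "(real ^ 'n) set \<Rightarrow> (complex ^ ('n::finite)) set" where
  "tube F = {w. (\<chi> j. Re (w $ j)) \<in> F}"

lemma exp_vec_in_log_preimage: "exp_vec w \<in> log_preimage F \<longleftrightarrow> w \<in> tube F"
  by (simp add: exp_vec_def log_preimage_def tube_def exp_in_torus log_map_exp)

lemma exp_vec_Ln: "z \<in> torus \<Longrightarrow> exp_vec (\<chi> j. Ln (z $ j)) = z"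
  by (simp add: exp_vec_def torus_def vec_eq_iff)

lemma continuous_on_exp_vec: "continuous_on S exp_vec"
  unfolding exp_vec_def by (intro continuous_intros)

lemma open_tube: "open F \<Longrightarrow> open (tube F)"
proof -
  assume "open F"
  moreover have "continuous_on UNIV (\<lambda>w :: complex ^ 'a. \<chi> j. Re (w $ j))"
    by (intro continuous_intros)
  ultimately show ?thesis
    unfolding tube_def using open_vimage[of F "\<lambda>w. \<chi> j. Re (w $ j)"] by (simp add: vimage_def)
qed

lemma convex_tube: "convex F \<Longrightarrow> convex (tube F)"
  unfolding tube_def convex_def
proof (intro ballI allI impI, unfold mem_Collect_eq)
  fix x y :: "complex ^ 'a" and u v :: real
  assume "\<forall>x\<in>F. \<forall>y\<in>F. \<forall>u\<ge>0. \<forall>v\<ge>0. u + v = 1 \<longrightarrow> u *\<^sub>R x + v *\<^sub>R y \<in> F"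
    "(\<chi> j. Re (x $ j)) \<in> F" "(\<chi> j. Re (y $ j)) \<in> F" "0 \<le> u" "0 \<le> v" "u + v = 1"
  then have "u *\<^sub>R (\<chi> j. Re (x $ j)) + v *\<^sub>R (\<chi> j. Re (y $ j)) \<in> F" by blast
  moreover have "u *\<^sub>R (\<chi> j. Re (x $ j)) + v *\<^sub>R (\<chi> j. Re (y $ j)) = (\<chi> j. Re ((u *\<^sub>R x + v *\<^sub>R y) $ j))"
    by (simp add: vec_eq_iff)
  ultimately show "(\<chi> j. Re ((u *\<^sub>R x + v *\<^sub>R y) $ j)) \<in> F" by simp
qed

lemma path_lift_exp_vec:
  fixes g :: "real \<Rightarrow> complex ^ 'n::finite"
  assumes g: "continuous_on {0..1} g" "\<And>t. t \<in> {0..1} \<Longrightarrow> g t \<in> torus"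
    and w: "exp_vec w = g 0"
  obtains \<eta> where "continuous_on {0..1} \<eta>" "\<And>t. t \<in> {0..1} \<Longrightarrow> exp_vec (\<eta> t) = g t" "\<eta> 0 = w"
proof -
  have "\<exists>h. continuous_on {0..1} h \<and> (\<forall>t\<in>{0..1}. g t $ j = exp (h t))" for j
  proof -
    have "continuous_on {0..1} (\<lambda>t. g t $ j)" by (intro continuous_intros g)
    moreover have "contractible {0..1::real}" by (intro convex_imp_contractible) simp
    ultimately show ?thesis
      by (rule continuous_logarithm_on_contractible) (use g(2) in \<open>auto simp: torus_def\<close>)
  qed
  then obtain h where h: "\<And>j. continuous_on {0..1} (h j)" "\<And>j t. t \<in> {0..1} \<Longrightarrow> g t $ j = exp (h j t)"
    by metis
  \<comment> \<open>Coordinatewise logarithms are shifted by constants so that the lift starts at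
    \<open>w\<close>.\<close>
  define \<eta> where "\<eta> t = (\<chi> j. h j t - h j 0 + w $ j)" for t
  have e: "exp (w $ j) = exp (h j 0)" for j
    using w h(2)[of 0 j] by (auto simp: exp_vec_def vec_eq_iff)
  show ?thesis
  proof
    show "continuous_on {0..1} \<eta>" unfolding \<eta>_def by (intro continuous_intros h)
    show "exp_vec (\<eta> t) = g t" if "t \<in> {0..1}" for t
      using h(2)[OF that] by (simp add: exp_vec_def \<eta>_def vec_eq_iff exp_add exp_diff e)
    show "\<eta> 0 = w" by (simp add: \<eta>_def vec_eq_iff)
  qed
qed

text \<open>Every path in the covering space is the image of a lifted path in the tube, so the image
  of the lift is a path component.\<close>

lemma covering_component_eq_lift_image:
  fixes p :: "'a::real_normed_vector \<Rightarrow> complex ^ 'n::finite"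
  assumes cov: "covering_space Y p (log_preimage F)" and F: "open F" "convex F"
    and C: "C \<in> components Y"
  obtains s where "continuous_on (tube F) s" "s \<in> tube F \<rightarrow> Y"
    "\<And>w. w \<in> tube F \<Longrightarrow> p (s w) = exp_vec w" "C = s ` tube F"
proof -
  let ?\<Omega> = "log_preimage F" and ?D = "tube F"
  obtain x0 where x0: "x0 \<in> Y" "C = connected_component_set Y x0"
    using C by (auto simp: components_def)
  have pY: "p x \<in> ?\<Omega>" if "x \<in> Y" for x using covering_space_imp_surjective[OF cov] that by blast
  define w0 where "w0 = (\<chi> j. Ln (p x0 $ j))"
  have w0: "exp_vec w0 = p x0"
    unfolding w0_def by (rule exp_vec_Ln) (use pY[OF x0(1)] in \<open>simp add: log_preimage_def\<close>)
  then have w0D: "w0 \<in> ?D" using pY[OF x0(1)] exp_vec_in_log_preimage by metis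
  obtain s where s: "continuous_on ?D s" "s \<in> ?D \<rightarrow> Y" "s w0 = x0" "\<And>w. w \<in> ?D \<Longrightarrow> p (s w) = exp_vec w"
  proof (rule covering_space_lift_strong[OF cov x0(1) w0D])
    show "simply_connected ?D" by (intro convex_imp_simply_connected convex_tube F)
    show "locally path_connected ?D" by (intro open_imp_locally_path_connected open_tube F)
    show "continuous_on ?D exp_vec" by (rule continuous_on_exp_vec)
    show "exp_vec \<in> ?D \<rightarrow> ?\<Omega>" by (auto simp: exp_vec_in_log_preimage)
  qed (use w0 in auto)
  have "s ` ?D \<subseteq> C"
    unfolding x0(2)
  proof (rule connected_component_maximal)
    show "x0 \<in> s ` ?D" using s(3) w0D by blast
    show "connected (s ` ?D)"
      by (intro connected_continuous_image s convex_connected convex_tube F)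
    show "s ` ?D \<subseteq> Y" using s(2) by blast
  qed
  moreover have "C \<subseteq> s ` ?D"
  proof
    fix x assume "x \<in> C"
    have "locally path_connected Y"
      using covering_space_locally_path_connected_eq[OF cov]
        open_imp_locally_path_connected[OF open_log_preimage[OF F(1)]] by blast
    then have "path_component Y x0 x"
      using \<open>x \<in> C\<close> x0(2) path_component_eq_connected_component by fastforce
    then obtain g where g: "path g" "path_image g \<subseteq> Y" "pathstart g = x0" "pathfinish g = x"
      unfolding path_component_def by blast
    then have gY: "g t \<in> Y" if "t \<in> {0..1}" for t using that by (auto simp: path_image_def)
    have gcont: "continuous_on {0..1} g" using g(1) by (simp add: path_def)
    have pg: "continuous_on {0..1} (\<lambda>t. p (g t))"
      by (rule continuous_on_compose2[OF covering_space_imp_continuous[OF cov] gcont]) (use gY in auto)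
    have gt: "p (g t) \<in> torus" if "t \<in> {0..1}" for t
      using pY[OF gY[OF that]] by (simp add: log_preimage_def)
    have "exp_vec w0 = p (g 0)" using w0 g(3) by (simp add: pathstart_def)
    from path_lift_exp_vec[OF pg gt this]
    obtain \<eta> where \<eta>: "continuous_on {0..1} \<eta>" "\<And>t. t \<in> {0..1} \<Longrightarrow> exp_vec (\<eta> t) = p (g t)" "\<eta> 0 = w0"
      by blast
    have \<eta>D: "\<eta> t \<in> ?D" if "t \<in> {0..1}" for t
      using \<eta>(2)[OF that] pY[OF gY[OF that]] exp_vec_in_log_preimage by metis
    \<comment> \<open>Both \<open>s\<close> along \<eta> and \<open>g\<close> lift the projected
      path from the same starting point, so they agree at the end.\<close>
    have "s (\<eta> 1) = g 1"
    proof (rule covering_space_lift_unique[OF cov, where f = "\<lambda>t. p (g t)" and T = "{0..1}" and a = 0 and ?g1.0 = "\<lambda>t. s (\<eta> t)"])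
      show "s (\<eta> 0) = g 0" using \<eta>(3) s(3) g(3) by (simp add: pathstart_def)
      show "continuous_on {0..1} (\<lambda>t. s (\<eta> t))"
        by (rule continuous_on_compose2[OF s(1) \<eta>(1)]) (use \<eta>D in auto)
    qed (use pg gcont gY pY s \<eta>D \<eta> in auto)
    then show "x \<in> s ` ?D" using \<eta>D[of 1] g(4) by (auto simp: pathfinish_def)
  qed
  ultimately show ?thesis using that s by blast
qed

subsection \<open>Periods of the lift and the parametrization\<close>

definition imag_vec :: "complex ^ 'n::finite \<Rightarrow> bool" where
  "imag_vec \<tau> \<longleftrightarrow> (\<forall>j. Re (\<tau> $ j) = 0)"

lemma tube_add_imag: "imag_vec \<tau> \<Longrightarrow> w + \<tau> \<in> tube F \<longleftrightarrow> w \<in> tube F"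
  by (simp add: tube_def imag_vec_def)

lemma exp_vec_add_period:
  "exp_vec (w + axis j (of_int n * (2 * of_real pi * \<i>))) = exp_vec w"
proof -
  have "exp (w $ j + of_int n * (2 * of_real pi * \<i>)) = exp (w $ j)"
    using exp_plus_2pin[of "w $ j" n] by (simp add: mult_ac)
  then show ?thesis by (auto simp: exp_vec_def vec_eq_iff axis_def)
qed

lemma imag_vec_axis: "imag_vec (axis j (of_int n * (2 * of_real pi * \<i>)))"
  by (simp add: imag_vec_def axis_def)

context
  fixes p :: "'a::real_normed_vector \<Rightarrow> complex ^ 'n::finite" and Y and F :: "(real ^ 'n) set" and s
  assumes cov: "covering_space Y p (log_preimage F)" and F: "convex F" "F \<noteq> {}"
    and fin: "\<And>y. y \<in> log_preimage F \<Longrightarrow> finite {x \<in> Y. p x = y}"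
    and s: "continuous_on (tube F) s" "s \<in> tube F \<rightarrow> Y" "\<And>w. w \<in> tube F \<Longrightarrow> p (s w) = exp_vec w"
begin

text \<open>All shifts by multiples of 2 pi i along one axis send a base point into a single finite
  fiber, so two of them agree there. Both are lifts of \<open>exp_vec\<close> on the connected tube,
  hence agree everywhere.\<close>

lemma lift_axis_period:
  obtains d :: nat where "d > 0" "\<And>w. w \<in> tube F \<Longrightarrow> s (w + axis j (of_nat d * (2 * of_real pi * \<i>))) = s w"
proof -
  define \<tau> where "\<tau> m = axis j (of_int m * (2 * of_real pi * \<i>))" for m :: int
  have im: "imag_vec (\<tau> m)" and per: "exp_vec (w + \<tau> m) = exp_vec w" for m w
    by (simp_all add: \<tau>_def imag_vec_axis exp_vec_add_period)
  have add: "\<tau> a + \<tau> b = \<tau> (a + b)" for a b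
    by (simp add: \<tau>_def vec_eq_iff axis_def algebra_simps)
  obtain u where "u \<in> F" using F(2) by blast
  then have w0: "(\<chi> j. of_real (u $ j)) \<in> tube F" (is "?w0 \<in> _") by (simp add: tube_def)
  have inD: "w + \<tau> m \<in> tube F" if "w \<in> tube F" for w m using that tube_add_imag[OF im] by blast
  have "range (\<lambda>m::nat. s (?w0 + \<tau> m)) \<subseteq> {x \<in> Y. p x = exp_vec ?w0}"
  proof clarify
    fix m :: nat
    show "s (?w0 + \<tau> m) \<in> Y \<and> p (s (?w0 + \<tau> m)) = exp_vec ?w0"
      using s(2) s(3)[OF inD[OF w0]] inD[OF w0] per by auto
  qed
  moreover have "exp_vec ?w0 \<in> log_preimage F" using w0 exp_vec_in_log_preimage by blast
  ultimately have "finite (range (\<lambda>m::nat. s (?w0 + \<tau> m)))" using fin finite_subset by blast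
  then have "\<not> inj (\<lambda>m::nat. s (?w0 + \<tau> m))" using finite_imageD infinite_UNIV_nat by blast
  then obtain m m' :: nat where mm: "m < m'" "s (?w0 + \<tau> m) = s (?w0 + \<tau> m')"
    unfolding inj_def by (metis linorder_neqE_nat)
  have lift: "continuous_on (tube F) (\<lambda>w. s (w + \<tau> i))" "(\<lambda>w. s (w + \<tau> i)) \<in> tube F \<rightarrow> Y"
    "v \<in> tube F \<Longrightarrow> exp_vec v = p (s (v + \<tau> i))" for i v
  proof -
    show "continuous_on (tube F) (\<lambda>w. s (w + \<tau> i))"
      by (rule continuous_on_compose2[OF s(1)]) (auto intro!: continuous_intros inD)
    show "(\<lambda>w. s (w + \<tau> i)) \<in> tube F \<rightarrow> Y" using s(2) inD by auto
    show "v \<in> tube F \<Longrightarrow> exp_vec v = p (s (v + \<tau> i))" using s(3)[OF inD] per by simp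
  qed
  have conn: "connected (tube F)" by (intro convex_connected convex_tube F)
  have expD: "exp_vec \<in> tube F \<rightarrow> log_preimage F" by (auto simp: exp_vec_in_log_preimage)
  have eq: "s (w + \<tau> m) = s (w + \<tau> m')" if w: "w \<in> tube F" for w
    by (rule covering_space_lift_unique[OF cov, where f = exp_vec and T = "tube F" and a = ?w0
        and ?g1.0 = "\<lambda>w. s (w + \<tau> m)" and ?g2.0 = "\<lambda>w. s (w + \<tau> m')",
        OF mm(2) continuous_on_exp_vec expD lift(1,2,3) lift(1,2,3) conn w0 w])
  show ?thesis
  proof (rule that[of "m' - m"])
    show "m' - m > 0" using mm by simp
    fix w assume w: "w \<in> tube F"
    \<comment> \<open>Shifting the argument back by \<open>m\<close> turns the coincidence into a
      period \<open>m' - m\<close>.\<close>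
    have "w + \<tau> (- int m) + \<tau> m = w" "w + \<tau> (- int m) + \<tau> m' = w + \<tau> (int m' - int m)"
      by (simp_all add: add.assoc add) (simp_all add: \<tau>_def vec_eq_iff axis_def)
    with eq[OF inD[OF w, of "- int m"]] have "s w = s (w + \<tau> (int m' - int m))" by simp
    moreover have "\<tau> (int m' - int m) = axis j (of_nat (m' - m) * (2 * of_real pi * \<i>))"
      using mm(1) by (simp add: \<tau>_def of_nat_diff)
    ultimately show "s (w + axis j (of_nat (m' - m) * (2 * of_real pi * \<i>))) = s w" by simp
  qed
qed

text \<open>Equal values of \<open>exp (w / d)\<close> mean that the arguments differ by 2 pi i
  \<open>d\<close> times an integer vector, and such vectors are periods once \<open>d\<close> is a
  multiple of every axis period.\<close>

lemma lift_period:
  obtains d :: nat where "d > 0" "\<And>w w'. w \<in> tube F \<Longrightarrow>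
    (\<And>j. exp (w' $ j / of_nat d) = exp (w $ j / of_nat d)) \<Longrightarrow> s w' = s w"
proof -
  have "\<exists>d::nat. d > 0 \<and> (\<forall>w\<in>tube F. s (w + axis j (of_nat d * (2 * of_real pi * \<i>))) = s w)" for j
    using lift_axis_period[of j] by metis
  then obtain e :: "'n \<Rightarrow> nat" where e: "\<And>j. e j > 0"
    "\<And>j w. w \<in> tube F \<Longrightarrow> s (w + axis j (of_nat (e j) * (2 * of_real pi * \<i>))) = s w" by metis
  \<comment> \<open>Any common multiple of the axis periods serves; with the product the cofactors
    \<open>c j\<close> are explicit.\<close>
  define d where "d = (\<Prod>j\<in>UNIV. e j)"
  have d: "d > 0" using e(1) by (simp add: d_def prod_pos)
  define per where "per \<tau> \<longleftrightarrow> imag_vec \<tau> \<and> (\<forall>w\<in>tube F. s (w + \<tau>) = s w)" for \<tau>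
  have per_add: "per (a + b)" if "per a" "per b" for a b
    using that tube_add_imag[of a] by (auto simp: per_def imag_vec_def add.assoc[symmetric])
  have per_uminus: "per (- a)" if "per a" for a
  proof -
    have "s (w + - a) = s w" if "w \<in> tube F" for w
    proof -
      have "w + - a \<in> tube F"
        using that \<open>per a\<close> tube_add_imag[of "- a"] by (auto simp: per_def imag_vec_def)
      then have "s (w + - a + a) = s (w + - a)" using \<open>per a\<close> by (simp only: per_def)
      then show ?thesis by simp
    qed
    then show ?thesis using that by (simp add: per_def imag_vec_def)
  qed
  have per_0: "per 0" by (simp add: per_def imag_vec_def)
  have per_nat: "per (of_nat n *\<^sub>R a)" if "per a" for n a
    by (induction n) (use that in \<open>auto simp: per_0 scaleR_add_left intro: per_add\<close>)
  have per_int: "per (of_int n *\<^sub>R a)" if "per a" for n a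
  proof (cases n)
    case (nonneg m)
    then show ?thesis using per_nat[OF that, of m] by simp
  next
    case (neg m)
    then have "real_of_int n = - real (Suc m)" by simp
    then show ?thesis
      using per_uminus[OF per_nat[OF that, of "Suc m"]] by (simp only: scaleR_minus_left)
  qed
  have per_sum: "per (\<Sum>j\<in>J. a j)" if "\<And>j. per (a j)" for J :: "'n set" and a
    by (induction J rule: infinite_finite_induct) (auto simp: per_0 that intro: per_add)
  show ?thesis
  proof (rule that[OF d])
    fix w w' assume w: "w \<in> tube F" and ex: "\<And>j. exp (w' $ j / of_nat d) = exp (w $ j / of_nat d)"
    have "\<exists>n::int. w' $ j - w $ j = of_int n * of_nat d * (2 * of_real pi * \<i>)" for j
    proof -
      obtain n :: int where "w' $ j / of_nat d = w $ j / of_nat d + (of_int (2 * n) * pi) * \<i>"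
        using ex[of j] unfolding exp_eq by blast
      then have "w' $ j - w $ j = of_int n * of_nat d * (2 * of_real pi * \<i>)"
        using d by (simp add: field_simps)
      then show ?thesis by blast
    qed
    then obtain n where n: "\<And>j. w' $ j - w $ j = of_int (n j) * of_nat d * (2 * of_real pi * \<i>)"
      by metis
    define c where "c j = (\<Prod>i\<in>UNIV - {j}. e i)" for j
    have dc: "d = e j * c j" for j by (simp add: d_def c_def prod.remove[of UNIV j])
    have dcc: "complex_of_nat d = of_nat (e j) * of_nat (c j)" for j
      unfolding dc[of j] by simp
    have "per (of_int (n j * int (c j)) *\<^sub>R axis j (of_nat (e j) * (2 * of_real pi * \<i>)))" for j
      using e(2)[of _ j] imag_vec_axis[of j "int (e j)"] by (intro per_int) (simp add: per_def)
    then have "per (\<Sum>j\<in>UNIV. of_int (n j * int (c j)) *\<^sub>R axis j (of_nat (e j) * (2 * of_real pi * \<i>)))"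
      by (rule per_sum)
    moreover have "(\<Sum>j\<in>UNIV. of_int (n j * int (c j)) *\<^sub>R axis j (of_nat (e j) * (2 * of_real pi * \<i>))) = w' - w"
    proof -
      have "(\<Sum>j\<in>UNIV. (of_int (n j * int (c j)) *\<^sub>R axis j (of_nat (e j) * (2 * of_real pi * \<i>))) $ i)
        = (\<Sum>j\<in>UNIV. if j = i then of_int (n j) * of_nat d * (2 * of_real pi * \<i>) else 0)" for i
        unfolding vector_scaleR_component
        by (intro sum.cong) (auto simp: axis_def scaleR_conv_of_real dcc[of i])
      then show ?thesis by (simp add: vec_eq_iff n)
    qed
    ultimately have "per (w' - w)" by simp
    then have "s (w + (w' - w)) = s w" using w unfolding per_def by blast
    then show "s w' = s w" by simp
  qed
qed

end

section \<open>Holomorphy of the last coordinates, and the parametrization\<close>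

definition snd_proj :: "complex ^ ('n::finite + 'm::finite) \<Rightarrow> complex ^ 'm" where
  "snd_proj z = (\<chi> j. z $ Inr j)"

lemma append_vec_proj: "append_vec (proj x) (snd_proj x) = x"
  by (simp add: append_vec_def proj_def snd_proj_def vec_eq_iff split: sum.splits)

lemma has_derivative_power_map:
  fixes z :: "complex ^ 'n::finite"
  obtains J :: "complex ^ 'n ^ 'n" where "(power_map d has_derivative (\<lambda>v. J *v v)) (at z)"
proof -
  let ?J = "(\<chi> i j. if j = i then of_nat d * z $ i ^ (d - 1) else 0) :: complex ^ 'n ^ 'n"
  have "((\<lambda>z. power_map d z $ i) has_derivative (\<lambda>v. (?J *v v) $ i)) (at z)" for i
  proof -
    have "((\<lambda>z::complex ^ 'n. z $ i) has_derivative (\<lambda>v. v $ i)) (at z)"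
      by (rule bounded_linear_imp_has_derivative) (rule bounded_linear_vec_nth)
    then have "((\<lambda>z. z $ i ^ d) has_derivative (\<lambda>v. of_nat d * v $ i * z $ i ^ (d - 1))) (at z)"
      by (rule has_derivative_power)
    moreover have "(?J *v v) $ i = of_nat d * v $ i * z $ i ^ (d - 1)" for v
    proof -
      have "(?J *v v) $ i = (\<Sum>j\<in>UNIV. if j = i then of_nat d * z $ i ^ (d - 1) * v $ j else 0)"
        unfolding matrix_vector_mult_def by (simp add: if_distrib[of "\<lambda>x. x * _"] cong: if_cong)
      then show ?thesis by simp
    qed
    ultimately show ?thesis by (simp add: power_map_def)
  qed
  then show ?thesis using that has_derivative_vec_components by blast
qed

lemma holomorphic_snd_section_power_map:
  fixes s :: "complex ^ 'n::finite \<Rightarrow> complex ^ ('n + 'm::finite)"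
  assumes "holomorphic_map_on s W" "power_map d z \<in> W"
  obtains J :: "complex ^ 'n ^ 'm" where
    "((\<lambda>z. snd_proj (s (power_map d z))) has_derivative (\<lambda>v. J *v v)) (at z)"
proof -
  obtain J1 :: "complex ^ 'n ^ ('n + 'm)" where J1: "(s has_derivative (\<lambda>v. J1 *v v)) (at (power_map d z))"
    using assms by (auto simp: holomorphic_map_on_def)
  obtain J2 :: "complex ^ 'n ^ 'n" where J2: "(power_map d has_derivative (\<lambda>v. J2 *v v)) (at z)"
    using has_derivative_power_map by blast
  define J3 :: "complex ^ 'n ^ 'm" where "J3 = (\<chi> j. J1 $ Inr j)"
  have "((\<lambda>z. snd_proj (s (power_map d z))) has_derivative (\<lambda>v. (J3 ** J2) *v v)) (at z)"
  proof (rule has_derivative_vec_components)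
    fix j
    have "((\<lambda>z. s (power_map d z)) has_derivative (\<lambda>v. J1 *v (J2 *v v))) (at z)"
      using diff_chain_at[OF J2 J1] by (simp add: o_def)
    then have "((\<lambda>z. s (power_map d z) $ Inr j) has_derivative (\<lambda>v. (J1 *v (J2 *v v)) $ Inr j)) (at z)"
      by (rule bounded_linear.has_derivative[OF bounded_linear_vec_nth])
    moreover have "(J1 *v (J2 *v v)) $ Inr j = ((J3 ** J2) *v v) $ j" for v
    proof -
      have "(J1 *v x) $ Inr j = (J3 *v x) $ j" for x
        by (simp add: matrix_vector_mult_def J3_def)
      then show ?thesis by (simp only: matrix_vector_mul_assoc[symmetric])
    qed
    ultimately show "((\<lambda>z. snd_proj (s (power_map d z)) $ j) has_derivative (\<lambda>v. ((J3 ** J2) *v v) $ j)) (at z)"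
      by (simp only: snd_proj_def vec_lambda_beta)
  qed
  then show ?thesis using that by blast
qed

lemma continuous_on_holomorphic_map: "holomorphic_map_on s W \<Longrightarrow> continuous_on W s"
  by (meson continuous_at_imp_continuous_on has_derivative_continuous holomorphic_map_on_def)

text \<open>Surjectivity is what makes the local sections inverse to charts with open target: the
  image of \<open>U\<close> becomes all of \<open>W\<close>.\<close>

lemma covering_space_over_log_preimage:
  fixes X :: "(complex ^ ('n::finite + 'm::finite)) set"
  assumes fin: "finite_projection X" and surj: "proj ` X = UNIV" and F: "open F"
    and disj: "log_preimage F \<inter> discriminant_locus X = {}"
  shows "covering_space (proj -` log_preimage F \<inter> X) proj (log_preimage F)"
proof (rule closed_local_homeomorphism_covering_space)
  show "continuous_on X proj" by (rule continuous_on_proj)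
  show "closed_map (top_of_set X) euclidean proj" using fin by (simp add: finite_projection_def proper_map_def)
  show "finite {x \<in> X. proj x = y}" for y :: "complex ^ 'n" using fin by (simp add: finite_projection_def)
  show "open (log_preimage F)" by (rule open_log_preimage[OF F])
  show "log_preimage F \<subseteq> proj ` X" by (simp add: surj)
  fix x assume x: "x \<in> X" "proj x \<in> log_preimage F"
  obtain U W s where U: "openin (top_of_set X) U" "x \<in> U" "open W" "holomorphic_map_on s W"
    "proj ` U = proj ` X \<inter> W" "\<And>u. u \<in> U \<Longrightarrow> s (proj u) = u"
    by (rule local_section[of x X]) (use x disj in auto)
  have UW: "proj ` U = W" using U(5) surj by simp
  have "homeomorphism U W proj s"
  proof (rule homeomorphismI)
    show "continuous_on U proj" by (rule continuous_on_proj)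
    show "continuous_on W s" by (rule continuous_on_holomorphic_map[OF U(4)])
  qed (use UW U(6) in auto)
  then show "\<exists>U W q. openin (top_of_set X) U \<and> x \<in> U \<and> open W \<and> homeomorphism U W proj q"
    using U by blast
qed

theorem theorem1:
  fixes X :: "(complex ^ ('n::finite + 'm::finite)) set"
    and \<delta> :: "'n cpoly"
    and F :: "(real ^ 'n) set"
    and \<Omega> :: "(complex ^ 'n) set"
    and C :: "(complex ^ ('n + 'm)) set"
  assumes "irreducible_variety X"
    and "variety_dim X = enat (CARD('n))"
    and "finite_projection X"
    and "\<delta> \<noteq> 0"
    and "discriminant_locus X \<subseteq> zero_locus \<delta>"
    and "F \<in> components (- amoeba \<delta>)"
    and "\<Omega> = log_preimage F"
    and "C \<in> components (proj -` \<Omega> \<inter> X)"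
  shows "\<exists>(d::nat) (\<Psi> :: complex ^ 'n \<Rightarrow> complex ^ 'm).
           d > 0 \<and> holomorphic_map_on \<Psi> (power_map d -` \<Omega>) \<and>
           C = {append_vec (power_map d z) (\<Psi> z) | z. z \<in> power_map d -` \<Omega>}"
proof -
  note F = amoeba_complement_component_convex[OF assms(6)]
  have Fne: "F \<noteq> {}" using in_components_nonempty[OF assms(6)] .
  have \<Omega>\<delta>: "\<Omega> \<inter> zero_locus \<delta> = {}"
    using log_preimage_disjoint[OF in_components_subset[OF assms(6)]] assms(7) by simp
  then have \<Omega>\<Delta>: "log_preimage F \<inter> discriminant_locus X = {}" using assms(5,7) by blast
  obtain x0 where "x0 \<in> C" using in_components_nonempty[OF assms(8)] by blast
  then have x0: "x0 \<in> X" "proj x0 \<in> \<Omega>" using in_components_subset[OF assms(8)] by auto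
  have surj: "proj ` X = UNIV"
    by (rule proj_surjective[OF assms(1-5) x0(1)]) (use x0 \<Omega>\<delta> in blast)
  let ?Y = "proj -` log_preimage F \<inter> X"
  have cov: "covering_space ?Y proj (log_preimage F)"
    by (rule covering_space_over_log_preimage[OF assms(3) surj F(1) \<Omega>\<Delta>])
  obtain s where s: "continuous_on (tube F) s" "s \<in> tube F \<rightarrow> ?Y"
    "\<And>w. w \<in> tube F \<Longrightarrow> proj (s w) = exp_vec w" "C = s ` tube F"
    using covering_component_eq_lift_image[OF cov F] assms(7,8) by blast
  have fin: "finite {x \<in> ?Y. proj x = y}" for y
  proof -
    have "finite {x \<in> X. proj x = y}" using assms(3) by (simp add: finite_projection_def)
    then show ?thesis by (rule rev_finite_subset) auto
  qed
  obtain d where d: "d > 0" and period: "\<And>w w'. w \<in> tube F \<Longrightarrow>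
    (\<And>j. exp (w' $ j / of_nat d) = exp (w $ j / of_nat d)) \<Longrightarrow> s w' = s w"
    using lift_period[OF cov F(2) Fne fin s(1-3)] by blast
  \<comment> \<open>A logarithm of \<open>power_map d z\<close>. The principal branch jumps, but any
    other branch changes \<open>l z\<close> by 2 pi i \<open>d\<close> times integers, which
    \<open>s\<close> does not see.\<close>
  define l where "l z = (\<chi> j. of_nat d * Ln (z $ j))" for z :: "complex ^ 'n"
  define \<Psi> where "\<Psi> z = snd_proj (s (l z))" for z
  let ?D = "power_map d -` \<Omega>"
  have nz: "z $ j \<noteq> 0" if "z \<in> ?D" for z j
    using that d by (auto simp: assms(7) log_preimage_def torus_def power_map_def zero_power)
  have El: "exp_vec (l z) = power_map d z" if "z \<in> ?D" for z
    using nz[OF that] by (simp add: exp_vec_def l_def power_map_def vec_eq_iff exp_of_nat_mult)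
  have lD: "l z \<in> tube F" if "z \<in> ?D" for z
    using El[OF that] that exp_vec_in_log_preimage[of "l z" F] by (simp add: assms(7))
  have psl: "append_vec (power_map d z) (\<Psi> z) = s (l z)" if "z \<in> ?D" for z
    using append_vec_proj[of "s (l z)"] s(3)[OF lD[OF that]] El[OF that] by (simp add: \<Psi>_def)
  have Ceq: "C = {append_vec (power_map d z) (\<Psi> z) | z. z \<in> ?D}"
  proof
    show "{append_vec (power_map d z) (\<Psi> z) | z. z \<in> ?D} \<subseteq> C"
      using psl lD s(4) by auto
    show "C \<subseteq> {append_vec (power_map d z) (\<Psi> z) | z. z \<in> ?D}"
    proof
      fix x assume "x \<in> C"
      then obtain w where w: "w \<in> tube F" "x = s w" using s(4) by blast
      \<comment> \<open>The \<open>d\<close>-th root of \<open>exp_vec w\<close> read off from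
        \<open>w\<close>; \<open>l z\<close> may differ from \<open>w\<close>, but only by a
        period.\<close>
      define z where "z = (\<chi> j. exp (w $ j / of_nat d))"
      have "power_map d z = exp_vec w"
        using d by (simp add: power_map_def z_def exp_vec_def vec_eq_iff flip: exp_of_nat_mult)
      then have z: "z \<in> ?D" using w(1) exp_vec_in_log_preimage[of w F] by (simp add: assms(7))
      have "s (l z) = s w"
        by (rule period[OF w(1)]) (use d in \<open>simp add: l_def z_def\<close>)
      then show "x \<in> {append_vec (power_map d z) (\<Psi> z) | z. z \<in> ?D}"
        using psl[OF z] z w(2) by (intro CollectI exI[of _ z]) simp
    qed
  qed
  have "\<exists>J :: complex ^ 'n ^ 'm. (\<Psi> has_derivative (\<lambda>v. J *v v)) (at z0)" if z0: "z0 \<in> ?D" for z0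
  proof -
    have x: "s (l z0) \<in> X" "proj (s (l z0)) = power_map d z0"
      using s(2,3) lD[OF z0] El[OF z0] by auto
    then have "proj (s (l z0)) \<notin> discriminant_locus X" using z0 \<Omega>\<Delta> assms(7) by auto
    from local_section[OF x(1) this] obtain U W \<sigma> where U: "openin (top_of_set X) U" "s (l z0) \<in> U" "open W" "holomorphic_map_on \<sigma> W"
      "proj ` U = proj ` X \<inter> W" "\<And>u. u \<in> U \<Longrightarrow> \<sigma> (proj u) = u"
      by blast
    obtain V where V: "open V" "U = X \<inter> V" using U(1) by (auto simp: openin_open)
    \<comment> \<open>A branch that agrees with \<open>l\<close> at \<open>z0\<close> and is
      continuous there, since its logarithm is taken near 1. It replaces \<open>l\<close> because
      \<open>s\<close> has the same value on both.\<close>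
    define b where "b z = (\<chi> j. l z0 $ j + of_nat d * Ln (z $ j / z0 $ j))" for z
    have b0: "b z0 = l z0" using nz[OF z0] by (simp add: b_def vec_eq_iff)
    have bcont: "isCont b z0"
      unfolding b_def continuous_at
      by (intro tendsto_intros) (use nz[OF z0] in \<open>auto simp: b_def\<close>)
    have "isCont s (b z0)"
      using s(1) lD[OF z0] open_tube[OF F(1)] by (simp add: b0 continuous_on_eq_continuous_at)
    then have sb: "isCont (\<lambda>z. s (b z)) z0" using bcont isCont_o2 by blast
    have ev1: "eventually (\<lambda>z. s (b z) \<in> V) (nhds z0)"
      using topological_tendstoD[OF sb[unfolded isCont_def] V(1)] V(2) U(2) b0
      by (simp add: eventually_nhds_conv_at)
    have pmcont: "continuous_on UNIV (power_map d :: complex ^ 'n \<Rightarrow> _)"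
      unfolding power_map_def by (intro continuous_intros)
    have "open ?D"
      using open_vimage[OF open_log_preimage[OF F(1)] pmcont] by (simp add: assms(7))
    then have ev2: "eventually (\<lambda>z. z \<in> ?D) (nhds z0)" using z0 by (rule eventually_nhds_in_open)
    \<comment> \<open>Continuity keeps \<open>s (b z)\<close> in the chart around
      \<open>s (l z0)\<close>, so near \<open>z0\<close> the map \<Psi> is the last part of a
      holomorphic section after \<open>power_map d\<close>.\<close>
    have ev: "eventually (\<lambda>z. snd_proj (\<sigma> (power_map d z)) = \<Psi> z) (nhds z0)"
      using ev1 ev2
    proof eventually_elim
      case (elim z)
      have bz: "exp (b z $ j / of_nat d) = exp (l z $ j / of_nat d)" for j
        using nz[OF elim(2)] nz[OF z0] d by (simp add: b_def l_def add_divide_distrib exp_add)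
      have sbl: "s (b z) = s (l z)" by (rule period[OF lD[OF elim(2)] bz])
      then have "s (l z) \<in> U" using elim(1) V(2) s(2) lD[OF elim(2)] by auto
      then have "\<sigma> (proj (s (l z))) = s (l z)" by (rule U(6))
      then show ?case using s(3)[OF lD[OF elim(2)]] El[OF elim(2)] by (simp add: \<Psi>_def)
    qed
    have "power_map d z0 \<in> W" using U(2,5) x(2) by (metis IntD2 imageI)
    then obtain J :: "complex ^ 'n ^ 'm" where
      J: "((\<lambda>z. snd_proj (\<sigma> (power_map d z))) has_derivative (\<lambda>v. J *v v)) (at z0)"
      using holomorphic_snd_section_power_map[OF U(4)] by blast
    have "(\<Psi> has_derivative (\<lambda>v. J *v v)) (at z0)"
      by (rule has_derivative_transform_eventually[OF J])
        (use ev in \<open>auto simp: eventually_nhds_conv_at\<close>)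
    then show ?thesis by blast
  qed
  then have "holomorphic_map_on \<Psi> ?D" by (simp add: holomorphic_map_on_def)
  then show ?thesis using d Ceq by blast
qed

end
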